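(* Let $P$ be a Hopf algebra over a field $k$ and let $M\subseteq P$ be a quantum embeddable homogeneous space of $P$ corresponding to $\pi:P\to C$, with canonical entwining map $\psi$ bijective. Then $M$ has a coalgebra frame resolution associated to the coalgebra bundle $P(M,C,\psi,\pi(1))$, with $V=M^+=\ker\epsilon\cap M$, left $C$-coaction ${}_V\Delta=(\pi\otimes\mathrm{id})\circ\Delta$, and $\theta:V\to P(\Omega^1M)$, $\theta(v)=S v_{(1)}\otimes v_{(2)}$. That is, $\theta$ is a right strongly tensorial one-form and $s_\theta:E=P\Box_CV\to\Omega^1M$, $s_\theta(\sum_iu^i\otimes v^i)=\sum_iu^i\theta(v^i)$, is an isomorphism of left $M$-modules.
   Context: Quantum embeddable homogeneous space: $P$ is a Hopf algebra with coproduct $\Delta$, counit $\epsilon$, antipode $S$; $M\subseteq P$ is a subalgebra with $\Delta(M)\subseteq P\otimes M$; $M^+=\ker\epsilon\cap M$; $C=P/(M^+P)$ is the quotient coalgebra with canonical surjection $\pi:P\to C$ and right coaction $\Delta_P=(\mathrm{id}\otimes\pi)\circ\Delta$ on $P$; it is assumed that $M=\{u\in P\mid\Delta_P(u)=u\otimes\pi(1)\}$. The canonical entwining map is $\psi:C\otimes P\to P\otimes C$, $\psi(c\otimes h)=h_{(1)}\otimes\pi(gh_{(2)})$ for any $g\in\pi^{-1}(c)$; then $P(M,C,\psi,e)$ with $e=\pi(1)$ is a copointed coalgebra bundle, i.e. $\Delta_P(u)=\psi(e\otimes u)$ and $P\otimes_MP\to P\otimes C$, $u\otimes_M v\mapsto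 u\Delta_P(v)$, is bijective. $\Omega^1M=\ker(\cdot:M\otimes M\to M)$, and $P(\Omega^1M)\subseteq P\otimes M$ is the left $P$-submodule of $P\otimes P$ generated by $\Omega^1M$. Let $\psi^2=(\mathrm{id}\otimes\psi)\circ(\psi\otimes\mathrm{id}):C\otimes P^{\otimes2}\to P^{\otimes2}\otimes C$. For a left $C$-comodule $V$, the left associated bundle is the cotensor product $E=P\Box_CV=\ker(\Delta_P\otimes\mathrm{id}-\mathrm{id}\otimes{}_V\Delta)\subseteq P\otimes V$. A right strongly tensorial one-form is a linear map $\phi:V\to P(\Omega^1M)$ with $\psi^{2}\circ(\mathrm{id}\otimes\phi)\circ{}_V\Delta=\phi\otimes e$. A coalgebra frame resolution of $M$ is such an $E$ associated to a copointed coalgebra bundle $P(M,C,\psi,e)$ with bijective $\psi$ and a left $C$-comodule $V$, together with a right strongly tensorial one-form $\theta:V\to P(\Omega^1M)$ such that $s_\theta:E\to\Omega^1M$, $\sum_iu^i\otimes v^i\mapsto\sum_iu^i\theta(v^i)$, is an isomorphism of left $M$-modules. *)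

theory Defs
  imports Complex_Main "HOL-Library.Function_Algebras"
begin

section \<open>Vector spaces\<close>

text \<open>A vector space over the field \<open>'k\<close> is given as a subspace \<open>carr\<close> of a type that is a
  \<open>'k\<close>-vector space under \<open>scl\<close>; addition is that of the type class.\<close>

record ('k, 'a) vs =
  carr :: "'a set"
  scl :: "'k \<Rightarrow> 'a \<Rightarrow> 'a"

definition vspace :: "('k::field, 'a::ab_group_add, 'z) vs_scheme \<Rightarrow> bool" where
  "vspace A \<longleftrightarrow> vector_space (scl A) \<and> module.subspace (scl A) (carr A)"

definition ambient :: "('k, 'a, 'z) vs_scheme \<Rightarrow> ('k, 'a) vs" where
  "ambient A = \<lparr>carr = UNIV, scl = scl A\<rparr>"

definition sub :: "('k, 'a, 'z) vs_scheme \<Rightarrow> 'a set \<Rightarrow> ('k, 'a) vs" where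
  "sub A W = \<lparr>carr = W, scl = scl A\<rparr>"

definition ground :: "('k::field, 'k) vs" where
  "ground = \<lparr>carr = UNIV, scl = (*)\<rparr>"

definition lin ::
  "('k::field, 'a::ab_group_add, 'y) vs_scheme \<Rightarrow> ('k, 'b::ab_group_add, 'z) vs_scheme \<Rightarrow> ('a \<Rightarrow> 'b) \<Rightarrow> bool"
  where "lin A X f \<longleftrightarrow>
    (\<forall>a\<in>carr A. f a \<in> carr X) \<and>
    (\<forall>a\<in>carr A. \<forall>b\<in>carr A. f (a + b) = f a + f b) \<and>
    (\<forall>c. \<forall>a\<in>carr A. f (scl A c a) = scl X c (f a))"

definition bilin ::
  "('k::field, 'a::ab_group_add, 'x) vs_scheme \<Rightarrow> ('k, 'b::ab_group_add, 'y) vs_scheme \<Rightarrow>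
   ('k, 'c::ab_group_add, 'z) vs_scheme \<Rightarrow> ('a \<Rightarrow> 'b \<Rightarrow> 'c) \<Rightarrow> bool"
  where "bilin A B X \<beta> \<longleftrightarrow>
    (\<forall>a\<in>carr A. lin B X (\<beta> a)) \<and> (\<forall>b\<in>carr B. lin A X (\<lambda>a. \<beta> a b))"

section \<open>Tensor products\<close>

text \<open>Over a field, \<open>A \<otimes> B\<close> embeds into the dual of the space of bilinear forms on \<open>A \<times> B\<close>, with
  \<open>a \<otimes> b\<close> acting as evaluation at \<open>(a, b)\<close>; the tensor product is realised as the span of these
  evaluations. Forms are taken on the ambient types, so that for subspaces \<open>A' \<subseteq> A\<close> and \<open>B' \<subseteq> B\<close>
  the canonical injection of \<open>A' \<otimes> B'\<close> into \<open>A \<otimes> B\<close> is a literal inclusion. The universal property is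
  \<open>tlift_universal\<close> below.\<close>

type_synonym ('a, 'b, 'k) tensor = "('a \<Rightarrow> 'b \<Rightarrow> 'k) \<Rightarrow> 'k"

definition tens ::
  "('k::field, 'a::ab_group_add, 'y) vs_scheme \<Rightarrow> ('k, 'b::ab_group_add, 'z) vs_scheme \<Rightarrow>
   'a \<Rightarrow> 'b \<Rightarrow> ('a, 'b, 'k) tensor"
  where "tens A B a b = (\<lambda>\<beta>. if bilin (ambient A) (ambient B) ground \<beta> then \<beta> a b else 0)"

definition tscale :: "'k::field \<Rightarrow> ('i \<Rightarrow> 'k) \<Rightarrow> 'i \<Rightarrow> 'k" where
  "tscale c t = (\<lambda>\<beta>. c * t \<beta>)"

definition tensor ::
  "('k::field, 'a::ab_group_add, 'y) vs_scheme \<Rightarrow> ('k, 'b::ab_group_add, 'z) vs_scheme \<Rightarrow>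
   ('k, ('a, 'b, 'k) tensor) vs"  (infixl "\<otimes>" 70)
  where "A \<otimes> B =
    \<lparr>carr = module.span tscale {tens A B a b | a b. a \<in> carr A \<and> b \<in> carr B}, scl = tscale\<rparr>"

text \<open>The map \<open>A \<otimes> B \<rightarrow> X\<close>, \<open>\<Sum>\<^sub>i a\<^sub>i \<otimes> b\<^sub>i \<mapsto> \<Sum>\<^sub>i \<beta> a\<^sub>i b\<^sub>i\<close>, induced by a bilinear \<open>\<beta>\<close>.\<close>

definition tlift ::
  "('k::field, 'a::ab_group_add, 'y) vs_scheme \<Rightarrow> ('k, 'b::ab_group_add, 'z) vs_scheme \<Rightarrow>
   ('a \<Rightarrow> 'b \<Rightarrow> 'x::ab_group_add) \<Rightarrow> ('a, 'b, 'k) tensor \<Rightarrow> 'x"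
  where "tlift A B \<beta> t =
    (THE x. \<exists>ps. set ps \<subseteq> carr A \<times> carr B \<and>
       t = (\<Sum>(a, b)\<leftarrow>ps. tens A B a b) \<and> x = (\<Sum>(a, b)\<leftarrow>ps. \<beta> a b))"

text \<open>\<open>tmap A B A' B' f g\<close> is \<open>f \<otimes> g : A \<otimes> B \<rightarrow> A' \<otimes> B'\<close>.\<close>

definition tmap ::
  "('k::field, 'a::ab_group_add, 'r) vs_scheme \<Rightarrow> ('k, 'b::ab_group_add, 's) vs_scheme \<Rightarrow>
   ('k, 'c::ab_group_add, 't) vs_scheme \<Rightarrow> ('k, 'd::ab_group_add, 'u) vs_scheme \<Rightarrow>
   ('a \<Rightarrow> 'c) \<Rightarrow> ('b \<Rightarrow> 'd) \<Rightarrow> ('a, 'b, 'k) tensor \<Rightarrow> ('c, 'd, 'k) tensor"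
  where "tmap A B A' B' f g = tlift A B (\<lambda>a b. tens A' B' (f a) (g b))"

text \<open>\<open>assoc_r : (A \<otimes> B) \<otimes> C \<rightarrow> A \<otimes> (B \<otimes> C)\<close>, with inverse \<open>assoc_l\<close>.\<close>

definition assoc_r ::
  "('k::field, 'a::ab_group_add, 'r) vs_scheme \<Rightarrow> ('k, 'b::ab_group_add, 's) vs_scheme \<Rightarrow>
   ('k, 'c::ab_group_add, 't) vs_scheme \<Rightarrow>
   (('a, 'b, 'k) tensor, 'c, 'k) tensor \<Rightarrow> ('a, ('b, 'c, 'k) tensor, 'k) tensor"
  where "assoc_r A B C =
    tlift (A \<otimes> B) C (\<lambda>t c. tlift A B (\<lambda>a b. tens A (B \<otimes> C) a (tens B C b c)) t)"

definition assoc_l ::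
  "('k::field, 'a::ab_group_add, 'r) vs_scheme \<Rightarrow> ('k, 'b::ab_group_add, 's) vs_scheme \<Rightarrow>
   ('k, 'c::ab_group_add, 't) vs_scheme \<Rightarrow>
   ('a, ('b, 'c, 'k) tensor, 'k) tensor \<Rightarrow> (('a, 'b, 'k) tensor, 'c, 'k) tensor"
  where "assoc_l A B C =
    tlift A (B \<otimes> C) (\<lambda>a t. tlift B C (\<lambda>b c. tens (A \<otimes> B) C (tens A B a b) c) t)"

section \<open>Hopf algebras\<close>

record ('k, 'a) coalg = "('k, 'a) vs" +
  comul :: "'a \<Rightarrow> ('a, 'a, 'k) tensor"
  counit :: "'a \<Rightarrow> 'k"

record ('k, 'a) hopf = "('k, 'a) coalg" +
  antipode :: "'a \<Rightarrow> 'a"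

definition coalgebra :: "('k::field, 'a::ab_group_add, 'z) coalg_scheme \<Rightarrow> bool" where
  "coalgebra C \<longleftrightarrow>
    vspace C \<and> lin C (C \<otimes> C) (comul C) \<and> lin C ground (counit C) \<and>
    (\<forall>c\<in>carr C. assoc_r C C C (tmap C C (C \<otimes> C) C (comul C) id (comul C c)) =
                tmap C C C (C \<otimes> C) id (comul C) (comul C c)) \<and>
    (\<forall>c\<in>carr C. tlift C C (\<lambda>a b. scl C (counit C a) b) (comul C c) = c) \<and>
    (\<forall>c\<in>carr C. tlift C C (\<lambda>a b. scl C (counit C b) a) (comul C c) = c)"

text \<open>An associative unital algebra occupies a whole type of class \<^class>\<open>ring_1\<close>.\<close>

definition algebra :: "('k::field, 'p::ring_1, 'z) vs_scheme \<Rightarrow> bool" where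
  "algebra P \<longleftrightarrow> vspace P \<and> carr P = UNIV \<and> bilin P P P (*)"

definition mult_map :: "('k::field, 'p::ring_1, 'z) vs_scheme \<Rightarrow> ('p, 'p, 'k) tensor \<Rightarrow> 'p" where
  "mult_map P = tlift P P (*)"

definition tensor_mult ::
  "('k::field, 'p::ring_1, 'z) vs_scheme \<Rightarrow> ('p, 'p, 'k) tensor \<Rightarrow> ('p, 'p, 'k) tensor \<Rightarrow> ('p, 'p, 'k) tensor"
  where "tensor_mult P s t =
    tlift P P (\<lambda>a b. tlift P P (\<lambda>c d. tens P P (a * c) (b * d)) t) s"

definition hopf_algebra :: "('k::field, 'p::ring_1, 'z) hopf_scheme \<Rightarrow> bool" where
  "hopf_algebra P \<longleftrightarrow>
    algebra P \<and> coalgebra P \<and>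
    comul P 1 = tens P P 1 1 \<and>
    (\<forall>x y. comul P (x * y) = tensor_mult P (comul P x) (comul P y)) \<and>
    counit P 1 = 1 \<and>
    (\<forall>x y. counit P (x * y) = counit P x * counit P y) \<and>
    lin P P (antipode P) \<and>
    (\<forall>x. mult_map P (tmap P P P P (antipode P) id (comul P x)) = scl P (counit P x) 1) \<and>
    (\<forall>x. mult_map P (tmap P P P P id (antipode P) (comul P x)) = scl P (counit P x) 1)"

definition subalgebra :: "('k::field, 'p::ring_1, 'z) vs_scheme \<Rightarrow> 'p set \<Rightarrow> bool" where
  "subalgebra P M \<longleftrightarrow>
    module.subspace (scl P) M \<and> 1 \<in> M \<and> (\<forall>x\<in>M. \<forall>y\<in>M. x * y \<in> M)"

section \<open>Quantum embeddable homogeneous spaces\<close>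

definition augmentation :: "('k::field, 'p::ring_1, 'z) coalg_scheme \<Rightarrow> 'p set \<Rightarrow> 'p set" where
  "augmentation P M = {m \<in> M. counit P m = 0}"

text \<open>\<open>C\<close> is the quotient of the coalgebra \<open>P\<close> by \<open>W\<close>, with \<open>\<pi>\<close> the canonical surjection. As \<open>\<pi>\<close> is
  onto, this fixes the coalgebra structure of \<open>C\<close>.\<close>

definition quotient_coalgebra ::
  "('k::field, 'p::ab_group_add, 'y) coalg_scheme \<Rightarrow> 'p set \<Rightarrow>
   ('k, 'c::ab_group_add, 'z) coalg_scheme \<Rightarrow> ('p \<Rightarrow> 'c) \<Rightarrow> bool"
  where "quotient_coalgebra P W C \<pi> \<longleftrightarrow>
    coalgebra C \<and> lin P C \<pi> \<and> \<pi> ` carr P = carr C \<and> {p \<in> carr P. \<pi> p = 0} = W \<and>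
    (\<forall>p\<in>carr P. comul C (\<pi> p) = tmap P P C C \<pi> \<pi> (comul P p)) \<and>
    (\<forall>p\<in>carr P. counit C (\<pi> p) = counit P p)"

definition right_coaction ::
  "('k::field, 'p::ring_1, 'y) coalg_scheme \<Rightarrow> ('k, 'c::ab_group_add, 'z) vs_scheme \<Rightarrow>
   ('p \<Rightarrow> 'c) \<Rightarrow> 'p \<Rightarrow> ('p, 'c, 'k) tensor"
  where "right_coaction P C \<pi> u = tmap P P P C id \<pi> (comul P u)"

definition quantum_embeddable_homogeneous_space ::
  "('k::field, 'p::ring_1, 'y) hopf_scheme \<Rightarrow> 'p set \<Rightarrow>
   ('k, 'c::ab_group_add, 'z) coalg_scheme \<Rightarrow> ('p \<Rightarrow> 'c) \<Rightarrow> bool"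
  where "quantum_embeddable_homogeneous_space P M C \<pi> \<longleftrightarrow>
    hopf_algebra P \<and> subalgebra P M \<and>
    (\<forall>m\<in>M. comul P m \<in> carr (P \<otimes> sub P M)) \<and>
    quotient_coalgebra P (module.span (scl P) {m * p | m p. m \<in> augmentation P M}) C \<pi> \<and>
    M = {u. right_coaction P C \<pi> u = tens P C u (\<pi> 1)}"

text \<open>Independence of the choice of \<open>g\<close> is \<open>canonical_entwining_tens\<close> below.\<close>

definition canonical_entwining ::
  "('k::field, 'p::ring_1, 'y) coalg_scheme \<Rightarrow> ('k, 'c::ab_group_add, 'z) vs_scheme \<Rightarrow>
   ('p \<Rightarrow> 'c) \<Rightarrow> ('c, 'p, 'k) tensor \<Rightarrow> ('p, 'c, 'k) tensor"
  where "canonical_entwining P C \<pi> =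
    tlift C P (\<lambda>c h. let g = (SOME g. \<pi> g = c) in tmap P P P C id (\<lambda>x. \<pi> (g * x)) (comul P h))"

section \<open>Copointed coalgebra bundles\<close>

text \<open>\<open>entwine2\<close> is \<open>\<psi>\<^sup>2 = (id \<otimes> \<psi>) \<circ> (\<psi> \<otimes> id) : C \<otimes> (P \<otimes> P) \<rightarrow> (P \<otimes> P) \<otimes> C\<close>.\<close>

definition entwine2 ::
  "('k::field, 'p::ring_1, 'y) vs_scheme \<Rightarrow> ('k, 'c::ab_group_add, 'z) vs_scheme \<Rightarrow>
   (('c, 'p, 'k) tensor \<Rightarrow> ('p, 'c, 'k) tensor) \<Rightarrow>
   ('c, ('p, 'p, 'k) tensor, 'k) tensor \<Rightarrow> (('p, 'p, 'k) tensor, 'c, 'k) tensor"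
  where "entwine2 P C \<psi> =
    assoc_l P P C \<circ> tmap P (C \<otimes> P) P (P \<otimes> C) id \<psi> \<circ> assoc_r P C P \<circ>
    tmap (C \<otimes> P) P (P \<otimes> C) P \<psi> id \<circ> assoc_l C P P"

text \<open>With \<open>\<mu>\<close>, \<open>1\<close> the structure of \<open>P\<close> and \<open>\<Delta>\<close>, \<open>\<epsilon>\<close> that of \<open>C\<close>, the last four conditions are
  \<open>\<psi> \<circ> (id \<otimes> \<mu>) = (\<mu> \<otimes> id) \<circ> \<psi>\<^sup>2\<close>, \<open>\<psi> (c \<otimes> 1) = 1 \<otimes> c\<close>,
  \<open>(id \<otimes> \<Delta>) \<circ> \<psi> = (\<psi> \<otimes> id) \<circ> (id \<otimes> \<psi>) \<circ> (\<Delta> \<otimes> id)\<close> and \<open>(id \<otimes> \<epsilon>) \<circ> \<psi> = \<epsilon> \<otimes> id\<close>.\<close>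

definition entwining_structure ::
  "('k::field, 'p::ring_1, 'y) vs_scheme \<Rightarrow> ('k, 'c::ab_group_add, 'z) coalg_scheme \<Rightarrow>
   (('c, 'p, 'k) tensor \<Rightarrow> ('p, 'c, 'k) tensor) \<Rightarrow> bool"
  where "entwining_structure P C \<psi> \<longleftrightarrow>
    algebra P \<and> coalgebra C \<and> lin (C \<otimes> P) (P \<otimes> C) \<psi> \<and>
    (\<forall>c\<in>carr C. \<forall>p q. \<psi> (tens C P c (p * q)) =
       tmap (P \<otimes> P) C P C (mult_map P) id (entwine2 P C \<psi> (tens C (P \<otimes> P) c (tens P P p q)))) \<and>
    (\<forall>c\<in>carr C. \<psi> (tens C P c 1) = tens P C 1 c) \<and>
    (\<forall>c\<in>carr C. \<forall>p. tmap P C P (C \<otimes> C) id (comul C) (\<psi> (tens C P c p)) =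
       assoc_r P C C (tmap (C \<otimes> P) C (P \<otimes> C) C \<psi> id (assoc_l C P C
         (tmap C (C \<otimes> P) C (P \<otimes> C) id \<psi> (assoc_r C C P (tens (C \<otimes> C) P (comul C c) p)))))) \<and>
    (\<forall>c\<in>carr C. \<forall>p. tlift P C (\<lambda>x d. scl P (counit C d) x) (\<psi> (tens C P c p)) =
       scl P (counit C c) p)"

text \<open>\<open>u \<cdot> t\<close>, multiplication on the first leg of \<open>t \<in> P \<otimes> B\<close>.\<close>

definition lact ::
  "('k::field, 'p::ring_1, 'y) vs_scheme \<Rightarrow> ('k, 'b::ab_group_add, 'z) vs_scheme \<Rightarrow>
   'p \<Rightarrow> ('p, 'b, 'k) tensor \<Rightarrow> ('p, 'b, 'k) tensor"
  where "lact P B u = tmap P B P B (\<lambda>x. u * x) id"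

text \<open>\<open>P \<otimes>\<^sub>M P\<close> is the set of cosets of the following subspace of \<open>P \<otimes> P\<close>.\<close>

definition balancing :: "('k::field, 'p::ring_1, 'z) vs_scheme \<Rightarrow> 'p set \<Rightarrow> ('p, 'p, 'k) tensor set" where
  "balancing P M =
    module.span tscale {tens P P (u * m) v - tens P P u (m * v) | u m v. m \<in> M}"

definition balanced_tensor ::
  "('k::field, 'p::ring_1, 'z) vs_scheme \<Rightarrow> 'p set \<Rightarrow> ('p, 'p, 'k) tensor set set" where
  "balanced_tensor P M = (\<lambda>t. (\<lambda>j. t + j) ` balancing P M) ` carr (P \<otimes> P)"

text \<open>\<open>u \<otimes> v \<mapsto> u \<Delta>\<^sub>P(v)\<close>, and the map it induces on cosets. (The condition on \<open>balancing\<close> in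
  \<open>copointed_coalgebra_bundle\<close> says that the latter is well defined.)\<close>

definition galois_map ::
  "('k::field, 'p::ring_1, 'y) vs_scheme \<Rightarrow> ('k, 'c::ab_group_add, 'z) vs_scheme \<Rightarrow>
   ('p \<Rightarrow> ('p, 'c, 'k) tensor) \<Rightarrow> ('p, 'p, 'k) tensor \<Rightarrow> ('p, 'c, 'k) tensor"
  where "galois_map P C \<Delta>P = tlift P P (\<lambda>u v. lact P C u (\<Delta>P v))"

definition balanced_galois_map ::
  "('k::field, 'p::ring_1, 'y) vs_scheme \<Rightarrow> ('k, 'c::ab_group_add, 'z) vs_scheme \<Rightarrow>
   ('p \<Rightarrow> ('p, 'c, 'k) tensor) \<Rightarrow> ('p, 'p, 'k) tensor set \<Rightarrow> ('p, 'c, 'k) tensor"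
  where "balanced_galois_map P C \<Delta>P Q = the_elem (galois_map P C \<Delta>P ` Q)"

definition copointed_coalgebra_bundle ::
  "('k::field, 'p::ring_1, 'y) vs_scheme \<Rightarrow> 'p set \<Rightarrow> ('k, 'c::ab_group_add, 'z) coalg_scheme \<Rightarrow>
   (('c, 'p, 'k) tensor \<Rightarrow> ('p, 'c, 'k) tensor) \<Rightarrow> 'c \<Rightarrow> ('p \<Rightarrow> ('p, 'c, 'k) tensor) \<Rightarrow> bool"
  where "copointed_coalgebra_bundle P M C \<psi> e \<Delta>P \<longleftrightarrow>
    entwining_structure P C \<psi> \<and>
    e \<in> carr C \<and> comul C e = tens C C e e \<and> counit C e = 1 \<and>
    (\<forall>u. \<Delta>P u = \<psi> (tens C P e u)) \<and>
    subalgebra P M \<and> M = {u. \<Delta>P u = tens P C u e} \<and>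
    (\<forall>j\<in>balancing P M. galois_map P C \<Delta>P j = 0) \<and>
    bij_betw (balanced_galois_map P C \<Delta>P) (balanced_tensor P M) (carr (P \<otimes> C))"

section \<open>Frame resolutions\<close>

definition left_comodule ::
  "('k::field, 'c::ab_group_add, 'y) coalg_scheme \<Rightarrow> ('k, 'v::ab_group_add, 'z) vs_scheme \<Rightarrow>
   ('v \<Rightarrow> ('c, 'v, 'k) tensor) \<Rightarrow> bool"
  where "left_comodule C V \<Delta>V \<longleftrightarrow>
    vspace V \<and> lin V (C \<otimes> V) \<Delta>V \<and>
    (\<forall>v\<in>carr V. assoc_r C C V (tmap C V (C \<otimes> C) V (comul C) id (\<Delta>V v)) =
                tmap C V C (C \<otimes> V) id \<Delta>V (\<Delta>V v)) \<and>
    (\<forall>v\<in>carr V. tlift C V (\<lambda>c w. scl V (counit C c) w) (\<Delta>V v) = v)"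

text \<open>\<open>one_forms\<close> is \<open>\<Omega>\<^sup>1M\<close> and \<open>generated_one_forms\<close> is \<open>P(\<Omega>\<^sup>1M)\<close>, both taken inside \<open>P \<otimes> P\<close>.\<close>

definition one_forms :: "('k::field, 'p::ring_1, 'z) vs_scheme \<Rightarrow> 'p set \<Rightarrow> ('k, ('p, 'p, 'k) tensor) vs" where
  "one_forms P M =
    sub (P \<otimes> P) {t \<in> carr (sub P M \<otimes> sub P M). mult_map P t = 0}"

definition generated_one_forms ::
  "('k::field, 'p::ring_1, 'z) vs_scheme \<Rightarrow> 'p set \<Rightarrow> ('k, ('p, 'p, 'k) tensor) vs" where
  "generated_one_forms P M =
    sub (P \<otimes> P) (module.span tscale {lact P P u \<omega> | u \<omega>. \<omega> \<in> carr (one_forms P M)})"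

definition strongly_tensorial ::
  "('k::field, 'p::ring_1, 'x) vs_scheme \<Rightarrow> 'p set \<Rightarrow> ('k, 'c::ab_group_add, 'y) vs_scheme \<Rightarrow>
   (('c, 'p, 'k) tensor \<Rightarrow> ('p, 'c, 'k) tensor) \<Rightarrow> 'c \<Rightarrow> ('k, 'v::ab_group_add, 'z) vs_scheme \<Rightarrow>
   ('v \<Rightarrow> ('c, 'v, 'k) tensor) \<Rightarrow> ('v \<Rightarrow> ('p, 'p, 'k) tensor) \<Rightarrow> bool"
  where "strongly_tensorial P M C \<psi> e V \<Delta>V \<phi> \<longleftrightarrow>
    lin V (generated_one_forms P M) \<phi> \<and>
    (\<forall>v\<in>carr V. entwine2 P C \<psi> (tmap C V C (P \<otimes> P) id \<phi> (\<Delta>V v)) = tens (P \<otimes> P) C (\<phi> v) e)"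

definition cotensor ::
  "('k::field, 'p::ring_1, 'x) vs_scheme \<Rightarrow> ('k, 'c::ab_group_add, 'y) vs_scheme \<Rightarrow>
   ('p \<Rightarrow> ('p, 'c, 'k) tensor) \<Rightarrow> ('k, 'v::ab_group_add, 'z) vs_scheme \<Rightarrow>
   ('v \<Rightarrow> ('c, 'v, 'k) tensor) \<Rightarrow> ('k, ('p, 'v, 'k) tensor) vs"
  where "cotensor P C \<Delta>P V \<Delta>V =
    sub (P \<otimes> V) {t \<in> carr (P \<otimes> V).
      assoc_r P C V (tmap P V (P \<otimes> C) V \<Delta>P id t) = tmap P V P (C \<otimes> V) id \<Delta>V t}"

definition frame_map ::
  "('k::field, 'p::ring_1, 'y) vs_scheme \<Rightarrow> ('k, 'v::ab_group_add, 'z) vs_scheme \<Rightarrow>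
   ('v \<Rightarrow> ('p, 'p, 'k) tensor) \<Rightarrow> ('p, 'v, 'k) tensor \<Rightarrow> ('p, 'p, 'k) tensor"
  where "frame_map P V \<theta> = tlift P V (\<lambda>u v. lact P P u (\<theta> v))"

definition left_module_iso ::
  "'p set \<Rightarrow> ('k::field, 'x::ab_group_add) vs \<Rightarrow> ('p \<Rightarrow> 'x \<Rightarrow> 'x) \<Rightarrow>
   ('k, 'y::ab_group_add) vs \<Rightarrow> ('p \<Rightarrow> 'y \<Rightarrow> 'y) \<Rightarrow> ('x \<Rightarrow> 'y) \<Rightarrow> bool"
  where "left_module_iso M X actX Y actY s \<longleftrightarrow>
    (\<forall>m\<in>M. \<forall>x\<in>carr X. actX m x \<in> carr X) \<and> (\<forall>m\<in>M. \<forall>y\<in>carr Y. actY m y \<in> carr Y) \<and>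
    lin X Y s \<and> bij_betw s (carr X) (carr Y) \<and>
    (\<forall>m\<in>M. \<forall>x\<in>carr X. s (actX m x) = actY m (s x))"

definition coalgebra_frame_resolution ::
  "('k::field, 'p::ring_1, 'x) vs_scheme \<Rightarrow> 'p set \<Rightarrow> ('k, 'c::ab_group_add, 'y) coalg_scheme \<Rightarrow>
   (('c, 'p, 'k) tensor \<Rightarrow> ('p, 'c, 'k) tensor) \<Rightarrow> 'c \<Rightarrow> ('p \<Rightarrow> ('p, 'c, 'k) tensor) \<Rightarrow>
   ('k, 'v::ab_group_add, 'z) vs_scheme \<Rightarrow> ('v \<Rightarrow> ('c, 'v, 'k) tensor) \<Rightarrow>
   ('v \<Rightarrow> ('p, 'p, 'k) tensor) \<Rightarrow> bool"
  where "coalgebra_frame_resolution P M C \<psi> e \<Delta>P V \<Delta>V \<theta> \<longleftrightarrow>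
    copointed_coalgebra_bundle P M C \<psi> e \<Delta>P \<and>
    bij_betw \<psi> (carr (C \<otimes> P)) (carr (P \<otimes> C)) \<and>
    left_comodule C V \<Delta>V \<and>
    strongly_tensorial P M C \<psi> e V \<Delta>V \<theta> \<and>
    left_module_iso M (cotensor P C \<Delta>P V \<Delta>V) (lact P V) (one_forms P M) (lact P P)
      (frame_map P V \<theta>)"

section \<open>The universal property of the tensor product\<close>

lemma vector_space_tscale: "vector_space (tscale :: 'k::field \<Rightarrow> ('i \<Rightarrow> 'k) \<Rightarrow> 'i \<Rightarrow> 'k)"
  by unfold_locales (auto simp: tscale_def fun_eq_iff algebra_simps)

interpretation ts: vector_space "tscale :: 'k::field \<Rightarrow> ('i \<Rightarrow> 'k) \<Rightarrow> 'i \<Rightarrow> 'k"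
  by (rule vector_space_tscale)

lemma sum_list_fun_apply: "(\<Sum>x\<leftarrow>xs. (f x :: 'i \<Rightarrow> 'k::comm_monoid_add)) \<beta> = (\<Sum>x\<leftarrow>xs. f x \<beta>)"
  by (induction xs) auto

lemma scl_tensor [simp]: "scl (A \<otimes> B) = tscale"
  by (simp add: tensor_def)

lemma vspace_tensor: "vspace (A \<otimes> B)"
  unfolding vspace_def by (simp add: tensor_def vector_space_tscale ts.subspace_span)

lemma tens_in_tensor: "a \<in> carr A \<Longrightarrow> b \<in> carr B \<Longrightarrow> tens A B a b \<in> carr (A \<otimes> B)"
  unfolding tensor_def by (auto intro!: ts.span_base)

lemma tens_bilinear:
  "tens A B (a + a') b = tens A B a b + tens A B a' b"
  "tens A B a (b + b') = tens A B a b + tens A B a b'"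
  "tens A B (scl A c a) b = tscale c (tens A B a b)"
  "tens A B a (scl B c b) = tscale c (tens A B a b)"
  by (auto simp: tens_def tscale_def fun_eq_iff bilin_def lin_def ambient_def ground_def)

lemma bilin_tens: "bilin A B (A \<otimes> B) (tens A B)"
  unfolding bilin_def lin_def by (auto simp: tens_bilinear tens_in_tensor)

lemma tensor_eq_sum_list:
  assumes A: "vspace A" and t: "t \<in> carr (A \<otimes> B)"
  obtains ps where "set ps \<subseteq> carr A \<times> carr B" "t = (\<Sum>(a, b)\<leftarrow>ps. tens A B a b)"
proof -
  let ?G = "{tens A B a b | a b. a \<in> carr A \<and> b \<in> carr B}"
  interpret A: vector_space "scl A" using A by (simp add: vspace_def)
  have sA: "A.subspace (carr A)" using A by (simp add: vspace_def)
  have "t \<in> ts.span ?G" using t by (simp add: tensor_def)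
  then have "\<exists>ps. set ps \<subseteq> carr A \<times> carr B \<and> t = (\<Sum>(a, b)\<leftarrow>ps. tens A B a b)"
  proof (induction rule: ts.span_induct_alt)
    case base
    show ?case by (rule exI[of _ "[]"]) simp
  next
    case (step c x y)
    then obtain a b ps where "a \<in> carr A" "b \<in> carr B" "x = tens A B a b"
      "set ps \<subseteq> carr A \<times> carr B" "y = (\<Sum>(a, b)\<leftarrow>ps. tens A B a b)" by blast
    then show ?case
      by (intro exI[of _ "(scl A c a, b) # ps"])
        (simp add: A.subspace_scale[OF sA] tens_bilinear)
  qed
  then show ?thesis using that by blast
qed

lemma exists_linear_projection:
  assumes "vspace A"
  obtains p where "lin (ambient A) A p" "\<And>a. a \<in> carr A \<Longrightarrow> p a = a"
proof -
  interpret A: vector_space "scl A" using assms by (simp add: vspace_def)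
  interpret AA: vector_space_pair "scl A" "scl A" ..
  have sub: "A.subspace (carr A)" using assms by (simp add: vspace_def)
  have "\<exists>g. g ` UNIV \<subseteq> carr A \<and> Vector_Spaces.linear (scl A) (scl A) g \<and> (\<forall>v\<in>carr A. g (id v) = v)"
    by (rule AA.linear_exists_left_inverse_on[OF A.linear_id sub]) simp
  then obtain g where g: "range g \<subseteq> carr A" "Vector_Spaces.linear (scl A) (scl A) g"
    "\<And>v. v \<in> carr A \<Longrightarrow> g v = v" by auto
  interpret g: Vector_Spaces.linear "scl A" "scl A" g by (rule g)
  show ?thesis
    by (rule that[of g]) (use g in \<open>auto simp: lin_def ambient_def g.add g.scale\<close>)
qed

lemma exists_separating_functional:
  assumes "vector_space s" "x \<noteq> 0"
  obtains f :: "'x::ab_group_add \<Rightarrow> 'k::field"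
  where "\<And>x y. f (x + y) = f x + f y" "\<And>c x. f (s c x) = c * f x" "f x \<noteq> 0"
proof -
  interpret X: vector_space s by (rule assms)
  interpret K: vector_space "(*) :: 'k \<Rightarrow> 'k \<Rightarrow> 'k" by unfold_locales (auto simp: algebra_simps)
  interpret XK: vector_space_pair s "(*) :: 'k \<Rightarrow> 'k \<Rightarrow> 'k" ..
  have "X.independent {x}" using assms(2) by simp
  from XK.linear_independent_extend[OF this, of "\<lambda>_. 1"]
  obtain f where f: "Vector_Spaces.linear s (*) f" "f x = 1" by auto
  interpret f: Vector_Spaces.linear s "(*)" f by (rule f)
  show ?thesis by (rule that[of f]) (use f in \<open>auto simp: f.add f.scale\<close>)
qed

lemma tlift_sum_list:
  assumes A: "vspace A" and B: "vspace B" and X: "vspace X" and \<beta>: "bilin A B X \<beta>"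
    and ps: "set ps \<subseteq> carr A \<times> carr B"
  shows "tlift A B \<beta> (\<Sum>(a, b)\<leftarrow>ps. tens A B a b) = (\<Sum>(a, b)\<leftarrow>ps. \<beta> a b)"
proof -
  have "(\<Sum>(a, b)\<leftarrow>qs. \<beta> a b) = (\<Sum>(a, b)\<leftarrow>ps. \<beta> a b)"
    if qs: "set qs \<subseteq> carr A \<times> carr B"
      and eq: "(\<Sum>(a, b)\<leftarrow>ps. tens A B a b) = (\<Sum>(a, b)\<leftarrow>qs. tens A B a b)" for qs
  proof (rule ccontr)
    assume neq: "\<not> ?thesis"
    obtain p where p: "lin (ambient A) A p" "\<And>a. a \<in> carr A \<Longrightarrow> p a = a"
      using exists_linear_projection[OF A] by blast
    obtain q where q: "lin (ambient B) B q" "\<And>b. b \<in> carr B \<Longrightarrow> q b = b"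
      using exists_linear_projection[OF B] by blast
    have vX: "vector_space (scl X)" using X by (simp add: vspace_def)
    from neq have "(\<Sum>(a, b)\<leftarrow>qs. \<beta> a b) - (\<Sum>(a, b)\<leftarrow>ps. \<beta> a b) \<noteq> 0" by simp
    from exists_separating_functional[OF vX this]
    obtain f where f: "\<And>x y. f (x + y) = f x + f y" "\<And>c x. f (scl X c x) = c * f x"
      and fne: "f ((\<Sum>(a, b)\<leftarrow>qs. \<beta> a b) - (\<Sum>(a, b)\<leftarrow>ps. \<beta> a b)) \<noteq> 0" by blast
    have "f (0 + 0) = f 0 + f 0" by (rule f(1))
    then have f0: "f 0 = 0" by (simp only: add_0_right add_cancel_right_right)
    define \<gamma> where "\<gamma> = (\<lambda>a b. f (\<beta> (p a) (q b)))"
    have bg: "bilin (ambient A) (ambient B) ground \<gamma>"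
      using p(1) q(1) \<beta>
      by (simp add: bilin_def lin_def ambient_def ground_def \<gamma>_def f)
    have *: "(\<Sum>(a, b)\<leftarrow>rs. tens A B a b) \<gamma> = f (\<Sum>(a, b)\<leftarrow>rs. \<beta> a b)"
      if "set rs \<subseteq> carr A \<times> carr B" for rs
      using that
    proof (induction rs)
      case (Cons r rs)
      then show ?case
        by (cases r) (auto simp: f tens_def bg, simp add: \<gamma>_def p q)
    qed (simp add: f0)
    have feq: "f (\<Sum>(a, b)\<leftarrow>qs. \<beta> a b) = f (\<Sum>(a, b)\<leftarrow>ps. \<beta> a b)"
      using eq *[OF ps] *[OF qs] by simp
    have "f ((\<Sum>(a, b)\<leftarrow>qs. \<beta> a b) - (\<Sum>(a, b)\<leftarrow>ps. \<beta> a b)) + f (\<Sum>(a, b)\<leftarrow>ps. \<beta> a b)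
        = f (\<Sum>(a, b)\<leftarrow>qs. \<beta> a b)"
      by (subst f(1)[symmetric]) simp
    with feq fne show False by simp
  qed
  then show ?thesis
    unfolding tlift_def using ps by (intro the_equality) blast+
qed

theorem tlift_universal:
  assumes A: "vspace A" and B: "vspace B" and X: "vspace X" and \<beta>: "bilin A B X \<beta>"
  shows "lin (A \<otimes> B) X (tlift A B \<beta>)"
    and "\<And>a b. a \<in> carr A \<Longrightarrow> b \<in> carr B \<Longrightarrow> tlift A B \<beta> (tens A B a b) = \<beta> a b"
    and "\<And>f t. lin (A \<otimes> B) X f \<Longrightarrow>
           (\<And>a b. a \<in> carr A \<Longrightarrow> b \<in> carr B \<Longrightarrow> f (tens A B a b) = \<beta> a b) \<Longrightarrow>
           t \<in> carr (A \<otimes> B) \<Longrightarrow> f t = tlift A B \<beta> t"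
proof -
  note L = tlift_sum_list[OF assms]
  interpret A: vector_space "scl A" using A by (simp add: vspace_def)
  interpret X: vector_space "scl X" using X by (simp add: vspace_def)
  have sA: "A.subspace (carr A)" and sX: "X.subspace (carr X)"
    using A X by (simp_all add: vspace_def)
  show *: "lin (A \<otimes> B) X (tlift A B \<beta>)"
    unfolding lin_def
  proof (intro conjI ballI allI)
    fix t assume "t \<in> carr (A \<otimes> B)"
    then obtain ps where ps: "set ps \<subseteq> carr A \<times> carr B" "t = (\<Sum>(a, b)\<leftarrow>ps. tens A B a b)"
      by (rule tensor_eq_sum_list[OF A])
    have "(\<Sum>(a, b)\<leftarrow>ps. \<beta> a b) \<in> carr X"
      using ps(1) \<beta>
      by (induction ps)
        (auto simp: bilin_def lin_def X.subspace_0[OF sX] intro!: X.subspace_add[OF sX])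
    then show "tlift A B \<beta> t \<in> carr X" using L ps by simp
    fix c
    let ?qs = "map (\<lambda>(a, b). (scl A c a, b)) ps"
    have "set ?qs \<subseteq> carr A \<times> carr B"
      using ps(1) A.subspace_scale[OF sA] by auto
    note Lq = L[OF this]
    have "(\<Sum>(a, b)\<leftarrow>?qs. tens A B a b) = tscale c t"
      unfolding ps(2)
      by (induction ps)
        (simp_all add: case_prod_beta tens_bilinear tscale_def fun_eq_iff distrib_left)
    moreover have "(\<Sum>(a, b)\<leftarrow>?qs. \<beta> a b) = scl X c (\<Sum>(a, b)\<leftarrow>ps. \<beta> a b)"
      using ps(1) \<beta> by (induction ps) (auto simp: bilin_def lin_def X.scale_right_distrib)
    ultimately show "tlift A B \<beta> (scl (A \<otimes> B) c t) = scl X c (tlift A B \<beta> t)"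
      using Lq L ps by simp
  next
    fix t u assume "t \<in> carr (A \<otimes> B)" "u \<in> carr (A \<otimes> B)"
    then obtain ps qs where ps: "set ps \<subseteq> carr A \<times> carr B" "t = (\<Sum>(a, b)\<leftarrow>ps. tens A B a b)"
      and qs: "set qs \<subseteq> carr A \<times> carr B" "u = (\<Sum>(a, b)\<leftarrow>qs. tens A B a b)"
      by (metis tensor_eq_sum_list[OF A])
    have "set (ps @ qs) \<subseteq> carr A \<times> carr B" using ps qs by auto
    from L[OF this] show "tlift A B \<beta> (t + u) = tlift A B \<beta> t + tlift A B \<beta> u"
      using L ps qs by simp
  qed
  show tens: "tlift A B \<beta> (tens A B a b) = \<beta> a b" if "a \<in> carr A" "b \<in> carr B" for a b
    using L[of "[(a, b)]"] that by simp
  show "f t = tlift A B \<beta> t"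
    if f: "lin (A \<otimes> B) X f" and eq: "\<And>a b. a \<in> carr A \<Longrightarrow> b \<in> carr B \<Longrightarrow> f (tens A B a b) = \<beta> a b"
      and t: "t \<in> carr (A \<otimes> B)" for f t
  proof -
    obtain ps where ps: "set ps \<subseteq> carr A \<times> carr B" "t = (\<Sum>(a, b)\<leftarrow>ps. tens A B a b)"
      using t by (rule tensor_eq_sum_list[OF A])
    have sT: "ts.subspace (carr (A \<otimes> B))" using vspace_tensor[of A B] by (simp add: vspace_def)
    have "0 \<in> carr (A \<otimes> B)" by (rule ts.subspace_0[OF sT])
    then have "f (0 + 0) = f 0 + f 0" using f unfolding lin_def by blast
    then have f0: "f 0 = 0" by simp
    have "(\<Sum>(a, b)\<leftarrow>ps. tens A B a b) \<in> carr (A \<otimes> B) \<and>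
      f (\<Sum>(a, b)\<leftarrow>ps. tens A B a b) = (\<Sum>(a, b)\<leftarrow>ps. \<beta> a b)"
      using ps(1)
    proof (induction ps)
      case Nil
      show ?case using f0 ts.subspace_0[OF sT] by (simp add: zero_fun_def)
    next
      case (Cons r rs)
      obtain a b where r: "r = (a, b)" by (cases r)
      with Cons have ab: "a \<in> carr A" "b \<in> carr B" by auto
      have "f (tens A B a b + (\<Sum>(a, b)\<leftarrow>rs. tens A B a b)) =
          f (tens A B a b) + f (\<Sum>(a, b)\<leftarrow>rs. tens A B a b)"
        using f Cons tens_in_tensor[OF ab] unfolding lin_def by simp
      moreover have "tens A B a b + (\<Sum>(a, b)\<leftarrow>rs. tens A B a b) \<in> carr (A \<otimes> B)"
        using Cons by (intro ts.subspace_add[OF sT] tens_in_tensor ab) simp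
      ultimately show ?case using Cons ab by (simp add: r eq plus_fun_def)
    qed
    then show ?thesis using L ps by simp
  qed
qed

section \<open>The canonical entwining map is well defined\<close>

lemma lin_compose: "lin A B f \<Longrightarrow> lin B D g \<Longrightarrow> lin A D (\<lambda>x. g (f x))"
  by (simp add: lin_def)

lemma bilin_tens_compose:
  assumes "lin A A' f" "lin B B' g"
  shows "bilin A B (A' \<otimes> B') (\<lambda>a b. tens A' B' (f a) (g b))"
  using assms by (auto simp: bilin_def lin_def tens_bilinear tens_in_tensor)

theorem canonical_entwining_tens:
  assumes Q: "quantum_embeddable_homogeneous_space P M C \<pi>"
  shows "lin (C \<otimes> P) (P \<otimes> C) (canonical_entwining P C \<pi>)"
    and "canonical_entwining P C \<pi> (tens C P (\<pi> g) h) =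
           tmap P P P C id (\<lambda>x. \<pi> (g * x)) (comul P h)"
proof -
  define W where "W = module.span (scl P) {m * p | m p. m \<in> augmentation P M}"
  from Q have hopf: "hopf_algebra P" and quot: "quotient_coalgebra P W C \<pi>"
    unfolding quantum_embeddable_homogeneous_space_def W_def by blast+
  from hopf have alg: "algebra P" and vP: "vspace P" and cU [simp]: "carr P = UNIV"
    and comul: "lin P (P \<otimes> P) (comul P)"
    by (simp_all add: hopf_algebra_def algebra_def coalgebra_def)
  from quot have vC: "vspace C" and pi: "lin P C \<pi>" and surj: "range \<pi> = carr C"
    and ker: "{p. \<pi> p = 0} = W"
    by (simp_all add: quotient_coalgebra_def coalgebra_def)
  interpret P: vector_space "scl P" using vP by (simp add: vspace_def)
  interpret C: vector_space "scl C" using vC by (simp add: vspace_def)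
  have sC: "scl P c (x * y) = scl P c x * y" "scl P c (x * y) = x * scl P c y" for c x y
    using alg by (simp_all add: algebra_def bilin_def lin_def)
  have pi_add: "\<pi> (x + y) = \<pi> x + \<pi> y" and pi_scale: "\<pi> (scl P c x) = scl C c (\<pi> x)"
    and pi_in: "\<pi> x \<in> carr C" for c x y
    using pi by (simp_all add: lin_def)
  have pi_diff: "\<pi> (x - y) = \<pi> x - \<pi> y" for x y
    using pi_add[of "x - y" y] by simp
  have right_ideal: "w * x \<in> W" if "w \<in> W" for w x
    using that unfolding W_def
  proof (induction rule: P.span_induct_alt)
    case base
    show ?case by (simp add: P.span_zero)
  next
    case (step c w y)
    then obtain m p where mp: "w = m * p" "m \<in> augmentation P M" by blast
    then have "w * x \<in> P.span {m * p | m p. m \<in> augmentation P M}"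
      by (intro P.span_base) (auto simp: mult.assoc)
    then have "scl P c (w * x) \<in> P.span {m * p | m p. m \<in> augmentation P M}"
      by (rule P.span_scale)
    with step show ?case
      by (simp add: distrib_right P.span_add flip: sC(1))
  qed
  define \<sigma> where "\<sigma> = (\<lambda>c. SOME g. \<pi> g = c)"
  have \<sigma>: "\<pi> (\<sigma> c) = c" if "c \<in> carr C" for c
    unfolding \<sigma>_def by (rule someI_ex) (metis that surj imageE)
  have indep: "\<pi> (g * x) = \<pi> (g' * x)" if "\<pi> g = \<pi> g'" for g g' x
  proof -
    have "g - g' \<in> W" using that ker pi_diff by auto
    then have "(g - g') * x \<in> W" by (rule right_ideal)
    then have "\<pi> (g * x - g' * x) = 0" using ker by (auto simp: left_diff_distrib)
    then show ?thesis by (simp add: pi_diff)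
  qed
  define \<beta> where "\<beta> = (\<lambda>c h. tmap P P P C id (\<lambda>x. \<pi> (\<sigma> c * x)) (comul P h))"
  have psi: "canonical_entwining P C \<pi> = tlift C P \<beta>"
    by (simp add: canonical_entwining_def \<beta>_def \<sigma>_def Let_def)
  have idP: "lin P P id" by (simp add: lin_def)
  have Lg: "lin P C (\<lambda>x. \<pi> (g * x))" for g
    by (simp add: lin_def distrib_left pi_add pi_in pi_scale flip: sC(2))
  note B = bilin_tens_compose[OF idP Lg]
  note U = tlift_universal[OF vP vP vspace_tensor B, folded tmap_def]
  have \<beta>_eq: "\<beta> (\<pi> g) h = tmap P P P C id (\<lambda>x. \<pi> (g * x)) (comul P h)" for g h
  proof -
    have "(\<lambda>x. \<pi> (\<sigma> (\<pi> g) * x)) = (\<lambda>x. \<pi> (g * x))"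
      using indep \<sigma>[OF pi_in] by blast
    then show ?thesis by (simp add: \<beta>_def)
  qed
  have lin_h: "lin P (P \<otimes> C) (\<beta> c)" for c
    unfolding \<beta>_def by (rule lin_compose[OF comul U(1)])
  have lin_c: "lin C (P \<otimes> C) (\<lambda>c. \<beta> c h)" for h
  proof -
    let ?F = "\<lambda>g. tmap P P P C id (\<lambda>x. \<pi> (g * x))"
    have t: "comul P h \<in> carr (P \<otimes> P)" using comul by (simp add: lin_def)
    obtain ps where ps: "set ps \<subseteq> carr P \<times> carr P" "comul P h = (\<Sum>(a, b)\<leftarrow>ps. tens P P a b)"
      by (rule tensor_eq_sum_list[OF vP t])
    have F: "?F g (comul P h) = (\<Sum>(a, b)\<leftarrow>ps. tens P C a (\<pi> (g * b)))" for g
      unfolding tmap_def ps(2) by (subst tlift_sum_list[OF vP vP vspace_tensor B ps(1)]) simp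
    have add: "?F (g + g') (comul P h) = ?F g (comul P h) + ?F g' (comul P h)" for g g'
      unfolding F by (induction ps) (auto simp: distrib_right pi_add tens_bilinear)
    have scale: "?F (scl P c g) (comul P h) = tscale c (?F g (comul P h))" for c g
      unfolding F by (induction ps)
        (simp_all add: case_prod_beta pi_scale tens_bilinear tscale_def fun_eq_iff distrib_left
          flip: sC(1))
    show ?thesis
      unfolding lin_def
    proof (intro conjI ballI allI)
      fix c assume c: "c \<in> carr C"
      show "\<beta> c h \<in> carr (P \<otimes> C)" using lin_h by (simp add: lin_def)
      obtain g where g: "c = \<pi> g" using c surj by blast
      show "\<beta> (scl C k c) h = scl (P \<otimes> C) k (\<beta> c h)" for k
        using scale by (simp add: g \<beta>_eq flip: pi_scale)
      fix c' assume "c' \<in> carr C"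
      then obtain g' where g': "c' = \<pi> g'" using surj by blast
      show "\<beta> (c + c') h = \<beta> c h + \<beta> c' h"
        using add by (simp add: g g' \<beta>_eq flip: pi_add)
    qed
  qed
  have "bilin C P (P \<otimes> C) \<beta>" using lin_h lin_c by (simp add: bilin_def)
  note V = tlift_universal[OF vC vP vspace_tensor this]
  show "lin (C \<otimes> P) (P \<otimes> C) (canonical_entwining P C \<pi>)"
    unfolding psi by (rule V(1))
  show "canonical_entwining P C \<pi> (tens C P (\<pi> g) h) =
      tmap P P P C id (\<lambda>x. \<pi> (g * x)) (comul P h)"
    unfolding psi using V(2)[of "\<pi> g" h] pi_in \<beta>_eq by simp
qed

end

theory Submission
  imports Defs
begin

text \<open>The linear map \<open>s(u \<otimes> v) = u S(v\<^sub>1) \<otimes> v\<^sub>2\<close> is a bijection of \<open>P \<otimes> P\<close> onto itself with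
  inverse \<open>\<kappa>(u \<otimes> v) = u v\<^sub>1 \<otimes> v\<^sub>2\<close>, by coassociativity and the antipode axioms. The map \<open>s\<^sub>\<theta>\<close> is the restriction
  of \<open>s\<close> to the cotensor product \<open>E\<close>, and the canonical map of the bundle is induced by \<open>(id \<otimes> \<pi>) \<circ> \<kappa>\<close>.
  Hence the Galois condition and the frame isomorphism are questions about which subspaces \<open>s\<close> and
  \<open>\<kappa>\<close> carry to each other.

  For the Galois condition, the kernel of \<open>id \<otimes> \<pi>\<close> is \<open>P \<otimes> M\<^sup>+P\<close>, and \<open>s\<close> maps it into the subspace
  that is divided out in \<open>P \<otimes>\<^sub>M P\<close>: modulo that subspace, \<open>s(u \<otimes> mp)\<close> is
  \<open>u S(m\<^sub>1 p\<^sub>1) m\<^sub>2 \<otimes> p\<^sub>2 = \<epsilon>(m) u S(p\<^sub>1) \<otimes> p\<^sub>2\<close> (\<open>frame_kernel\<close>),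
  which is \<open>0\<close> for \<open>m \<in> M\<^sup>+\<close>.

  For the frame isomorphism, \<open>\<kappa>\<close> maps \<open>\<Omega>\<^sup>1M\<close> into \<open>E\<close> because \<open>\<Delta>\<^sub>P\<close> is left \<open>M\<close>-linear and \<open>\<Delta>\<close> is
  coassociative (\<open>coframe_one_forms\<close>). Conversely let \<open>t = \<Sum> u \<otimes> v\<close> lie in \<open>E\<close>. Then \<open>s(t)\<close> is in
  \<open>P \<otimes> M\<close> and has product \<open>0\<close>, and what remains is that its first leg lies in \<open>M\<close>. The map
  \<open>x \<otimes> \<pi>(y) \<otimes> v \<mapsto> x (S v\<^sub>1)\<^sub>1 \<otimes> \<pi>(y (S v\<^sub>1)\<^sub>2) \<otimes> v\<^sub>2\<close> sends one side of the cotensor equation for \<open>t\<close>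
  to \<open>(\<Delta>\<^sub>P \<otimes> id) s(t)\<close> and the other side to \<open>s(t)\<close> with \<open>\<pi>(1)\<close> inserted in the middle
  (\<open>insert_antipode_cot_left\<close>, \<open>insert_antipode_cot_right\<close>). As \<open>M\<close> is the kernel of
  \<open>u \<mapsto> \<Delta>\<^sub>P(u) - u \<otimes> \<pi>(1)\<close> and tensoring over a field is exact (\<open>tensor_kernel_left\<close>), \<open>s(t) \<in> M \<otimes> M\<close>.

  That \<open>\<theta>\<close> is strongly tensorial and the last step both rest on \<open>(S v\<^sub>2)\<^sub>1 \<otimes> v\<^sub>1 (S v\<^sub>2)\<^sub>2 = S v \<otimes> 1\<close>
  (\<open>antipode_comul_absorb\<close>). Computations with iterated coproducts are done with a Sweedler sum
  \<open>sw x F\<close>, which stands for \<open>\<Sum> F x\<^sub>1 x\<^sub>2\<close>.\<close>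

section \<open>Linear maps on tensor products\<close>

lemma lin_in: "lin A X f \<Longrightarrow> a \<in> carr A \<Longrightarrow> f a \<in> carr X"
  by (simp add: lin_def)

lemma lin_add: "lin A X f \<Longrightarrow> a \<in> carr A \<Longrightarrow> b \<in> carr A \<Longrightarrow> f (a + b) = f a + f b"
  by (simp add: lin_def)

lemma lin_scale: "lin A X f \<Longrightarrow> a \<in> carr A \<Longrightarrow> f (scl A c a) = scl X c (f a)"
  by (simp add: lin_def)

lemma lin_id: "lin A A id"
  by (simp add: lin_def)

lemma vspace_zero: "vspace A \<Longrightarrow> 0 \<in> carr A"
  using module.subspace_0[of "scl A" "carr A"]
  by (simp add: vspace_def flip: module_iff_vector_space)

lemma vspace_add: "vspace A \<Longrightarrow> a \<in> carr A \<Longrightarrow> b \<in> carr A \<Longrightarrow> a + b \<in> carr A"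
  using module.subspace_add[of "scl A" "carr A"]
  by (simp add: vspace_def flip: module_iff_vector_space)

lemma vspace_scale: "vspace A \<Longrightarrow> a \<in> carr A \<Longrightarrow> scl A c a \<in> carr A"
  by (simp add: vspace_def module.subspace_scale flip: module_iff_vector_space)

lemma vspace_diff: "vspace A \<Longrightarrow> a \<in> carr A \<Longrightarrow> b \<in> carr A \<Longrightarrow> a - b \<in> carr A"
  using module.subspace_diff[of "scl A" "carr A"]
  by (simp add: vspace_def flip: module_iff_vector_space)

lemma vspace_sum_list:
  "vspace A \<Longrightarrow> (\<And>x. x \<in> set xs \<Longrightarrow> F x \<in> carr A) \<Longrightarrow> (\<Sum>x\<leftarrow>xs. F x) \<in> carr A"
  by (induction xs) (auto simp: vspace_zero vspace_add)

lemma vspace_scale_add: "vspace A \<Longrightarrow> scl A c (x + y) = scl A c x + scl A c y"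
  by (simp add: vspace_def vector_space_def)

lemma vspace_scale_zero: "vspace A \<Longrightarrow> scl A c 0 = 0"
  using vspace_scale_add[of A c 0 0] by simp

lemma lin_zero: "vspace A \<Longrightarrow> lin A X f \<Longrightarrow> f 0 = 0"
  using lin_add[of A X f 0 0] by (simp add: vspace_zero)

lemma lin_diff:
  "vspace A \<Longrightarrow> lin A X f \<Longrightarrow> a \<in> carr A \<Longrightarrow> b \<in> carr A \<Longrightarrow> f (a - b) = f a - f b"
  using lin_add[of A X f "a - b" b] by (simp add: vspace_diff)

lemma lin_sum_list:
  assumes "vspace A" "lin A X f" "\<And>x. x \<in> set xs \<Longrightarrow> F x \<in> carr A"
  shows "f (\<Sum>x\<leftarrow>xs. F x) = (\<Sum>x\<leftarrow>xs. f (F x))"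
  using assms(3)
  by (induction xs)
    (simp_all add: lin_zero[OF assms(1,2)] lin_add[OF assms(2)] vspace_sum_list[OF assms(1)])

lemma vspace_sub: "vspace A \<Longrightarrow> module.subspace (scl A) W \<Longrightarrow> vspace (sub A W)"
  by (simp add: vspace_def sub_def)

lemma carr_sub [simp]: "carr (sub A W) = W"
  and scl_sub [simp]: "scl (sub A W) = scl A"
  and carr_ambient [simp]: "carr (ambient A) = UNIV"
  and scl_ambient [simp]: "scl (ambient A) = scl A"
  by (simp_all add: sub_def ambient_def)

lemma vspace_ambient: "vspace A \<Longrightarrow> vspace (ambient A)"
  using module.subspace_UNIV[of "scl A"]
  by (simp add: vspace_def vector_space_def module_def)

lemma tens_cong: "scl A = scl A' \<Longrightarrow> scl B = scl B' \<Longrightarrow> tens A B = tens A' B'"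
  unfolding tens_def ambient_def by simp

text \<open>Forms are taken on ambient types, so tensors over a subspace are literally tensors over the
  whole space. This is what allows maps on \<open>V = M\<^sup>+\<close> to be computed in \<open>P\<close>.\<close>
lemma tens_sub [simp]:
  "tens (sub A W) B = tens A B" "tens A (sub B U) = tens A B"
  "tens A (B \<otimes> sub D W') = tens A (B \<otimes> D)" "tens (B \<otimes> sub D W') A = tens (B \<otimes> D) A"
  by (rule tens_cong; simp)+

lemma tens_tscale [simp]:
  "tens (A \<otimes> B) D (tscale c t) d = tscale c (tens (A \<otimes> B) D t d)"
  "tens D (A \<otimes> B) d (tscale c t) = tscale c (tens D (A \<otimes> B) d t)"
  using tens_bilinear(3)[of "A \<otimes> B" D c t d] tens_bilinear(4)[of D "A \<otimes> B" d c t] by simp_all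

text \<open>Equality of functions, for rewriting inside \<open>\<lambda>a b. tens A B (\<dots>) b\<close>, which is stored eta-contracted.\<close>
lemma tens_linear_fun:
  "tens A B (a + a') = (\<lambda>b. tens A B a b + tens A B a' b)"
  "tens A B (scl A c a) = (\<lambda>b. tscale c (tens A B a b))"
  by (rule ext, rule tens_bilinear)+

lemma tensor_mono: "carr A \<subseteq> carr A' \<Longrightarrow> carr B \<subseteq> carr B' \<Longrightarrow> scl A = scl A' \<Longrightarrow> scl B = scl B'
  \<Longrightarrow> carr (A \<otimes> B) \<subseteq> carr (A' \<otimes> B')"
  using tens_cong[of A A' B B'] by (auto simp: tensor_def intro!: ts.span_mono)

lemma tensor_lin_into_subspace:
  assumes "vspace A" "vspace X" "lin (A \<otimes> B) X f" "t \<in> carr (A \<otimes> B)"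
    and J: "module.subspace (scl X) J"
    and "\<And>a b. a \<in> carr A \<Longrightarrow> b \<in> carr B \<Longrightarrow> f (tens A B a b) \<in> J"
  shows "f t \<in> J"
proof -
  obtain ps where ps: "set ps \<subseteq> carr A \<times> carr B" "t = (\<Sum>(a, b)\<leftarrow>ps. tens A B a b)"
    using assms by (metis tensor_eq_sum_list)
  have "f t = (\<Sum>p\<leftarrow>ps. f (case p of (a, b) \<Rightarrow> tens A B a b))"
    unfolding ps(2) using ps(1)
    by (intro lin_sum_list[OF vspace_tensor assms(3)]) (auto simp: tens_in_tensor)
  also have "\<dots> \<in> carr (sub X J)"
    using ps(1) assms(6) by (intro vspace_sum_list vspace_sub assms J) auto
  finally show ?thesis by simp
qed

lemma tensor_lin_eq:
  assumes "vspace A" "lin (A \<otimes> B) X f" "lin (A \<otimes> B) Y g" "t \<in> carr (A \<otimes> B)"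
    and "\<And>a b. a \<in> carr A \<Longrightarrow> b \<in> carr B \<Longrightarrow> f (tens A B a b) = g (tens A B a b)"
  shows "f t = g t"
proof -
  obtain ps where ps: "set ps \<subseteq> carr A \<times> carr B" "t = (\<Sum>(a, b)\<leftarrow>ps. tens A B a b)"
    using assms by (metis tensor_eq_sum_list)
  have *: "(case p of (a, b) \<Rightarrow> tens A B a b) \<in> carr (A \<otimes> B)" if "p \<in> set ps" for p
    using that ps(1) by (auto simp: tens_in_tensor)
  have eq: "f (case p of (a, b) \<Rightarrow> tens A B a b) = g (case p of (a, b) \<Rightarrow> tens A B a b)"
    if "p \<in> set ps" for p
    using that ps(1) assms(5) by auto
  show ?thesis
    using lin_sum_list[OF vspace_tensor assms(2), of ps "\<lambda>(a, b). tens A B a b", OF *]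
      lin_sum_list[OF vspace_tensor assms(3), of ps "\<lambda>(a, b). tens A B a b", OF *]
    unfolding ps(2) by (metis (no_types, lifting) eq map_cong)
qed

lemma tlift_restrict:
  assumes "vspace A" "vspace B" "vspace X" "bilin A B X \<beta>"
    and "vspace A'" "vspace B'" "carr A' \<subseteq> carr A" "carr B' \<subseteq> carr B" "scl A' = scl A" "scl B' = scl B"
    and t: "t \<in> carr (A' \<otimes> B')"
  shows "tlift A' B' \<beta> t = tlift A B \<beta> t"
proof -
  obtain ps where ps: "set ps \<subseteq> carr A' \<times> carr B'" "t = (\<Sum>(a, b)\<leftarrow>ps. tens A' B' a b)"
    using assms by (metis tensor_eq_sum_list)
  have "bilin A' B' X \<beta>"
    using assms(4,7-10) by (auto simp: bilin_def lin_def subset_iff)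
  note L = tlift_sum_list[OF assms(5,6,3) this ps(1)]
  have "tens A' B' = tens A B" using assms by (intro tens_cong) auto
  moreover have "set ps \<subseteq> carr A \<times> carr B" using ps(1) assms by auto
  ultimately show ?thesis
    using L tlift_sum_list[OF assms(1-4), of ps] by (simp add: ps(2))
qed

text \<open>Trilinear maps lift one pair of arguments at a time; this and the next lemma give the bilinearity
  that a second application of the universal property asks for.\<close>
lemma tlift_bilin_left:
  assumes "vspace A" "vspace B" "vspace X" "vspace D"
    and "\<And>d. d \<in> carr D \<Longrightarrow> bilin A B X (\<lambda>a b. \<tau> a b d)"
    and "\<And>a b. a \<in> carr A \<Longrightarrow> b \<in> carr B \<Longrightarrow> lin D X (\<tau> a b)"
  shows "bilin (A \<otimes> B) D X (\<lambda>t d. tlift A B (\<lambda>a b. \<tau> a b d) t)"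
  unfolding bilin_def
proof (intro conjI ballI)
  fix d assume "d \<in> carr D"
  then show "lin (A \<otimes> B) X (\<lambda>t. tlift A B (\<lambda>a b. \<tau> a b d) t)"
    using assms by (intro tlift_universal(1)) auto
next
  fix t assume t: "t \<in> carr (A \<otimes> B)"
  obtain ps where ps: "set ps \<subseteq> carr A \<times> carr B" "t = (\<Sum>(a, b)\<leftarrow>ps. tens A B a b)"
    using assms(1) t by (metis tensor_eq_sum_list)
  have eq: "tlift A B (\<lambda>a b. \<tau> a b d) t = (\<Sum>(a, b)\<leftarrow>ps. \<tau> a b d)" if "d \<in> carr D" for d
    unfolding ps(2) using assms that ps(1) by (intro tlift_sum_list) auto
  have "lin D X (\<lambda>d. (\<Sum>(a, b)\<leftarrow>ps. \<tau> a b d))"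
    using ps(1)
  proof (induction ps)
    case Nil
    show ?case by (simp add: lin_def vspace_zero vspace_scale_zero assms)
  next
    case (Cons p ps)
    then show ?case
      using assms(6)[of "fst p" "snd p"]
      by (cases p) (auto simp: lin_def vspace_add vspace_scale_add assms)
  qed
  then show "lin D X (\<lambda>d. tlift A B (\<lambda>a b. \<tau> a b d) t)"
    by (simp add: lin_def eq vspace_add vspace_scale assms)
qed

lemma tlift_bilin_right:
  assumes "vspace A" "vspace B" "vspace X" "vspace D"
    and "\<And>d. d \<in> carr D \<Longrightarrow> bilin A B X (\<tau> d)"
    and "\<And>a b. a \<in> carr A \<Longrightarrow> b \<in> carr B \<Longrightarrow> lin D X (\<lambda>d. \<tau> d a b)"
  shows "bilin D (A \<otimes> B) X (\<lambda>d t. tlift A B (\<tau> d) t)"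
  using tlift_bilin_left[of A B X D "\<lambda>a b d. \<tau> d a b"] assms
  by (simp add: bilin_def)

lemma lin_tmap:
  assumes "vspace A" "vspace B" "lin A A' f" "lin B B' g"
  shows "lin (A \<otimes> B) (A' \<otimes> B') (tmap A B A' B' f g)"
  unfolding tmap_def
  using tlift_universal(1)[OF assms(1,2) vspace_tensor bilin_tens_compose[OF assms(3,4)]] .

lemma tmap_tens:
  assumes "vspace A" "vspace B" "lin A A' f" "lin B B' g" "a \<in> carr A" "b \<in> carr B"
  shows "tmap A B A' B' f g (tens A B a b) = tens A' B' (f a) (g b)"
  unfolding tmap_def
  using tlift_universal(2)[OF assms(1,2) vspace_tensor bilin_tens_compose[OF assms(3,4)] assms(5,6)] .

lemma assoc_r:
  assumes "vspace A" "vspace B" "vspace C"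
  shows bilin_assoc_r: "bilin (A \<otimes> B) C (A \<otimes> (B \<otimes> C))
      (\<lambda>t c. tlift A B (\<lambda>a b. tens A (B \<otimes> C) a (tens B C b c)) t)"
    and lin_assoc_r: "lin ((A \<otimes> B) \<otimes> C) (A \<otimes> (B \<otimes> C)) (assoc_r A B C)"
    and assoc_r_tens: "\<And>a b c. a \<in> carr A \<Longrightarrow> b \<in> carr B \<Longrightarrow> c \<in> carr C \<Longrightarrow>
      assoc_r A B C (tens (A \<otimes> B) C (tens A B a b) c) = tens A (B \<otimes> C) a (tens B C b c)"
proof -
  have 1: "bilin A B (A \<otimes> (B \<otimes> C)) (\<lambda>a b. tens A (B \<otimes> C) a (tens B C b c))" if "c \<in> carr C" for c
    using that by (simp add: bilin_def lin_def tens_in_tensor tens_bilinear)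
  show 2: "bilin (A \<otimes> B) C (A \<otimes> (B \<otimes> C))
     (\<lambda>t c. tlift A B (\<lambda>a b. tens A (B \<otimes> C) a (tens B C b c)) t)"
    using assms 1
    by (intro tlift_bilin_left vspace_tensor) (auto simp: lin_def tens_in_tensor tens_bilinear)
  note U = tlift_universal[OF vspace_tensor assms(3) vspace_tensor 2]
  show "lin ((A \<otimes> B) \<otimes> C) (A \<otimes> (B \<otimes> C)) (assoc_r A B C)"
    unfolding assoc_r_def by (rule U)
  show "assoc_r A B C (tens (A \<otimes> B) C (tens A B a b) c) = tens A (B \<otimes> C) a (tens B C b c)"
    if "a \<in> carr A" "b \<in> carr B" "c \<in> carr C" for a b c
    unfolding assoc_r_def using that
    by (simp add: U(2) tens_in_tensor tlift_universal(2)[OF assms(1,2) vspace_tensor 1])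
qed

lemma assoc_l:
  assumes "vspace A" "vspace B" "vspace C"
  shows lin_assoc_l: "lin (A \<otimes> (B \<otimes> C)) ((A \<otimes> B) \<otimes> C) (assoc_l A B C)"
    and assoc_l_tens: "\<And>a b c. a \<in> carr A \<Longrightarrow> b \<in> carr B \<Longrightarrow> c \<in> carr C \<Longrightarrow>
      assoc_l A B C (tens A (B \<otimes> C) a (tens B C b c)) = tens (A \<otimes> B) C (tens A B a b) c"
proof -
  have 1: "bilin B C ((A \<otimes> B) \<otimes> C) (\<lambda>b c. tens (A \<otimes> B) C (tens A B a b) c)" if "a \<in> carr A" for a
    using that by (simp add: bilin_def lin_def tens_in_tensor tens_bilinear)
  have 2: "bilin A (B \<otimes> C) ((A \<otimes> B) \<otimes> C)
     (\<lambda>a t. tlift B C (\<lambda>b c. tens (A \<otimes> B) C (tens A B a b) c) t)"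
    using assms 1
    by (intro tlift_bilin_right vspace_tensor) (auto simp: lin_def tens_in_tensor tens_bilinear)
  note U = tlift_universal[OF assms(1) vspace_tensor vspace_tensor 2]
  show "lin (A \<otimes> (B \<otimes> C)) ((A \<otimes> B) \<otimes> C) (assoc_l A B C)"
    unfolding assoc_l_def by (rule U)
  show "assoc_l A B C (tens A (B \<otimes> C) a (tens B C b c)) = tens (A \<otimes> B) C (tens A B a b) c"
    if "a \<in> carr A" "b \<in> carr B" "c \<in> carr C" for a b c
    unfolding assoc_l_def using that
    by (simp add: U(2) tens_in_tensor tlift_universal(2)[OF assms(2,3) vspace_tensor 1])
qed

lemma lin_minus: "vspace X \<Longrightarrow> lin A X f \<Longrightarrow> lin A X g \<Longrightarrow> lin A X (\<lambda>x. f x - g x)"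
proof -
  assume X: "vspace X" and fg: "lin A X f" "lin A X g"
  interpret X: vector_space "scl X" using X by (simp add: vspace_def)
  show ?thesis
    using fg by (simp add: lin_def vspace_diff[OF X] X.scale_right_diff_distrib)
qed

lemma tens_diff: "tens A B (a - a') b = tens A B a b - tens A B a' b"
  using tens_bilinear(1)[of A B "a - a'" a' b] by simp

lemma lin_restrict: "lin A X f \<Longrightarrow> carr A' \<subseteq> carr A \<Longrightarrow> scl A' = scl A \<Longrightarrow> lin A' X f"
  unfolding lin_def subset_iff by simp

lemma tens_zero [simp]: "tens A B 0 = (\<lambda>b. 0)" "tens A B a 0 = 0"
  using tens_bilinear(1)[of A B 0 0] tens_bilinear(2)[of A B a 0 0] by auto

lemma lin_image_subspace:
  assumes A: "vspace A" and X: "vspace X" and f: "lin A X f"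
  shows "module.subspace (scl X) (f ` carr A)"
proof -
  interpret X: vector_space "scl X" using X by (simp add: vspace_def)
  show ?thesis
  proof (rule X.subspaceI)
    show "0 \<in> f ` carr A" using lin_zero[OF A f] vspace_zero[OF A] by (metis imageI)
    show "x + y \<in> f ` carr A" if "x \<in> f ` carr A" "y \<in> f ` carr A" for x y
      using that vspace_add[OF A] lin_add[OF f] by (metis (no_types, lifting) imageE imageI)
    show "scl X c x \<in> f ` carr A" if "x \<in> f ` carr A" for c x
      using that vspace_scale[OF A] lin_scale[OF f] by (metis (no_types, lifting) imageE imageI)
  qed
qed

lemma vspace_ground: "vspace (ground :: ('k::field, 'k) vs)"
proof -
  interpret vector_space "(*) :: 'k \<Rightarrow> 'k \<Rightarrow> 'k" by unfold_locales (auto simp: algebra_simps)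
  show ?thesis using subspace_UNIV vector_space_axioms by (simp add: vspace_def ground_def)
qed

lemma tens_ground: "tens A ground a r = tscale r (tens A ground a 1)"
  using tens_bilinear(4)[of A ground a r 1] by (simp add: ground_def)

lemma tmap_restrict:
  assumes "vspace A" "vspace B" "module.subspace (scl B) W" "W \<subseteq> carr B" "lin A A' f" "lin B B' g"
    and "t \<in> carr (A \<otimes> sub B W)"
  shows "tmap A (sub B W) A' B' f g t = tmap A B A' B' f g t"
  unfolding tmap_def
  using assms by (intro tlift_restrict[OF _ _ vspace_tensor bilin_tens_compose]) (auto intro: vspace_sub)

lemma assoc_r_restrict:
  assumes "vspace A" "vspace B" "vspace D" "module.subspace (scl D) W" "W \<subseteq> carr D"
    and "t \<in> carr ((A \<otimes> B) \<otimes> sub D W)"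
  shows "assoc_r A B (sub D W) t = assoc_r A B D t"
  unfolding assoc_r_def tens_sub
  by (rule tlift_restrict[OF vspace_tensor assms(3) vspace_tensor bilin_assoc_r[OF assms(1-3)]])
    (use assms in \<open>auto simp: vspace_sub vspace_tensor\<close>)

text \<open>Every linear map over a field is von Neumann regular. Such an \<open>r\<close> splits \<open>id\<close> on \<open>A\<close> as
  \<open>(id - r \<circ> D) + r \<circ> D\<close>, where the first summand takes values in the kernel of \<open>D\<close>.\<close>
lemma lin_right_inverse:
  assumes A: "vspace A" and X: "vspace X" and D: "lin A X D"
  obtains r where "lin X A r" "\<And>a. a \<in> carr A \<Longrightarrow> D (r (D a)) = D a"
proof -
  interpret A: vector_space "scl A" using A by (simp add: vspace_def)
  interpret X: vector_space "scl X" using X by (simp add: vspace_def)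
  interpret AX: vector_space_pair "scl A" "scl X" ..
  have sub: "A.subspace (carr A)" using A by (simp add: vspace_def)
  obtain p where p: "lin (ambient A) A p" "\<And>a. a \<in> carr A \<Longrightarrow> p a = a"
    using exists_linear_projection[OF A] by blast
  have "Vector_Spaces.linear (scl A) (scl X) (\<lambda>a. D (p a))"
    using p(1) D A.vector_space_axioms X.vector_space_axioms
    by unfold_locales (auto simp: lin_def)
  from AX.linear_exists_right_inverse_on[OF this sub]
  obtain r where r: "range r \<subseteq> carr A" "Vector_Spaces.linear (scl X) (scl A) r"
    "\<forall>v\<in>(\<lambda>a. D (p a)) ` carr A. D (p (r v)) = v" by auto
  interpret r: Vector_Spaces.linear "scl X" "scl A" r by (rule r)
  show ?thesis
  proof
    show "lin X A r" using r(1) by (auto simp: lin_def r.add r.scale)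
    show "D (r (D a)) = D a" if "a \<in> carr A" for a
      using r(1,3) that p(2) by (metis imageI rangeI subsetD)
  qed
qed

text \<open>Exactness of tensoring over a field. Tensoring the splitting \<open>id = (id - r \<circ> D) + r \<circ> D\<close> with \<open>B\<close>
  and applying it to \<open>t\<close>, the second summand vanishes and the first lies in \<open>ker D \<otimes> B\<close>.\<close>
lemma tensor_kernel_left:
  assumes A: "vspace A" and B: "vspace B" and X: "vspace X" and D: "lin A X D"
    and t: "t \<in> carr (A \<otimes> B)" and t0: "tmap A B X B D id t = 0"
  shows "t \<in> carr (sub A {a \<in> carr A. D a = 0} \<otimes> B)"
proof -
  obtain r where r: "lin X A r" "\<And>a. a \<in> carr A \<Longrightarrow> D (r (D a)) = D a"
    by (rule lin_right_inverse[OF A X D]) blast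
  let ?N = "sub A {a \<in> carr A. D a = 0}"
  let ?f = "\<lambda>t. t - tmap X B A B r id (tmap A B X B D id t)"
  have l1: "lin (A \<otimes> B) (A \<otimes> B) (\<lambda>t. tmap X B A B r id (tmap A B X B D id t))"
    by (rule lin_compose[OF lin_tmap lin_tmap]) (use assms r lin_id in auto)
  have f: "lin (A \<otimes> B) (A \<otimes> B) ?f"
    using l1 by (auto simp: lin_def vspace_diff[OF vspace_tensor] ts.scale_right_diff_distrib)
  have "?f t \<in> carr (?N \<otimes> B)"
  proof (rule tensor_lin_into_subspace[OF A vspace_tensor f t])
    show "module.subspace (scl (A \<otimes> B)) (carr (?N \<otimes> B))"
      using vspace_tensor[of ?N B] by (simp add: vspace_def)
    fix a b assume ab: "a \<in> carr A" "b \<in> carr B"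
    then have "?f (tens A B a b) = tens A B a b - tens A B (r (D a)) b"
      using D r(1) by (simp add: tmap_tens A B X lin_id lin_in)
    also have "\<dots> = tens A B (a - r (D a)) b"
      using tens_bilinear(1)[of A B "a - r (D a)" "r (D a)" b] by simp
    also have "\<dots> \<in> carr (?N \<otimes> B)"
    proof -
      have "r (D a) \<in> carr A" using D r(1) ab by (simp add: lin_in)
      then have "a - r (D a) \<in> carr ?N"
        using ab by (simp add: vspace_diff A lin_diff[OF A D] r(2))
      from tens_in_tensor[OF this ab(2)] show ?thesis by simp
    qed
    finally show "?f (tens A B a b) \<in> carr (?N \<otimes> B)" .
  qed
  moreover have "tmap X B A B r id 0 = 0"
    by (rule lin_zero[OF vspace_tensor lin_tmap]) (use assms r lin_id in auto)
  ultimately show ?thesis using t0 by simp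
qed

lemma tensor_kernel_right:
  assumes A: "vspace A" and B: "vspace B" and X: "vspace X" and D: "lin B X D"
    and t: "t \<in> carr (A \<otimes> B)" and t0: "tmap A B A X id D t = 0"
  shows "t \<in> carr (A \<otimes> sub B {b \<in> carr B. D b = 0})"
proof -
  obtain r where r: "lin X B r" "\<And>b. b \<in> carr B \<Longrightarrow> D (r (D b)) = D b"
    by (rule lin_right_inverse[OF B X D]) blast
  let ?N = "sub B {b \<in> carr B. D b = 0}"
  let ?f = "\<lambda>t. t - tmap A X A B id r (tmap A B A X id D t)"
  have l1: "lin (A \<otimes> B) (A \<otimes> B) (\<lambda>t. tmap A X A B id r (tmap A B A X id D t))"
    by (rule lin_compose[OF lin_tmap lin_tmap]) (use assms r lin_id in auto)
  have f: "lin (A \<otimes> B) (A \<otimes> B) ?f"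
    using l1 by (auto simp: lin_def vspace_diff[OF vspace_tensor] ts.scale_right_diff_distrib)
  have "?f t \<in> carr (A \<otimes> ?N)"
  proof (rule tensor_lin_into_subspace[OF A vspace_tensor f t])
    show "module.subspace (scl (A \<otimes> B)) (carr (A \<otimes> ?N))"
      using vspace_tensor[of A ?N] by (simp add: vspace_def)
    fix a b assume ab: "a \<in> carr A" "b \<in> carr B"
    then have "?f (tens A B a b) = tens A B a b - tens A B a (r (D b))"
      using D r(1) by (simp add: tmap_tens A B X lin_id lin_in)
    also have "\<dots> = tens A B a (b - r (D b))"
      using tens_bilinear(2)[of A B a "b - r (D b)" "r (D b)"] by simp
    also have "\<dots> \<in> carr (A \<otimes> ?N)"
    proof -
      have "r (D b) \<in> carr B" using D r(1) ab by (simp add: lin_in)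
      then have "b - r (D b) \<in> carr ?N"
        using ab by (simp add: vspace_diff B lin_diff[OF B D] r(2))
      from tens_in_tensor[OF ab(1) this] show ?thesis by simp
    qed
    finally show "?f (tens A B a b) \<in> carr (A \<otimes> ?N)" .
  qed
  moreover have "tmap A X A B id r 0 = 0"
    by (rule lin_zero[OF vspace_tensor lin_tmap]) (use assms r lin_id in auto)
  ultimately show ?thesis using t0 by simp
qed

text \<open>The first isomorphism theorem, for quotients represented by sets of cosets.\<close>
lemma bij_betw_cosets:
  assumes A: "vspace A" and f: "lin A X f" and surj: "f ` carr A = carr X"
    and J: "J = {a \<in> carr A. f a = 0}"
  shows "bij_betw (\<lambda>Q. the_elem (f ` Q)) ((\<lambda>a. (\<lambda>j. a + j) ` J) ` carr A) (carr X)"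
proof -
  have f0: "f 0 = 0" "0 \<in> carr A" using lin_zero[OF A f] vspace_zero[OF A] by auto
  have elem: "the_elem (f ` ((\<lambda>j. a + j) ` J)) = f a" if "a \<in> carr A" for a
  proof -
    have "f ` ((\<lambda>j. a + j) ` J) = {f a}"
      using that f0 by (auto simp: J lin_add[OF f] intro: rev_image_eqI[of 0])
    then show ?thesis by simp
  qed
  have eq: "(\<lambda>j. a + j) ` J = (\<lambda>j. b + j) ` J" if "a \<in> carr A" "b \<in> carr A" "f a = f b" for a b
  proof -
    have "(\<lambda>j. a + j) ` J \<subseteq> (\<lambda>j. b + j) ` J" if "a \<in> carr A" "b \<in> carr A" "f a = f b" for a b
    proof
      fix x assume "x \<in> (\<lambda>j. a + j) ` J"
      then obtain j where j: "x = a + j" "j \<in> carr A" "f j = 0" by (auto simp: J)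
      then have "a - b + j \<in> J"
        using that by (simp add: J lin_add[OF f] lin_diff[OF A f] vspace_add vspace_diff A)
      moreover have "x = b + (a - b + j)" using j by simp
      ultimately show "x \<in> (\<lambda>j. b + j) ` J" by blast
    qed
    from this[of a b] this[of b a] that show ?thesis by auto
  qed
  show ?thesis
    unfolding bij_betw_def
  proof
    show "inj_on (\<lambda>Q. the_elem (f ` Q)) ((\<lambda>a. (\<lambda>j. a + j) ` J) ` carr A)"
    proof (rule inj_onI)
      fix Q R assume QR: "Q \<in> (\<lambda>a. (\<lambda>j. a + j) ` J) ` carr A" "R \<in> (\<lambda>a. (\<lambda>j. a + j) ` J) ` carr A"
        "the_elem (f ` Q) = the_elem (f ` R)"
      then obtain a b where "a \<in> carr A" "b \<in> carr A" "Q = (\<lambda>j. a + j) ` J" "R = (\<lambda>j. b + j) ` J"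
        by blast
      with QR(3) show "Q = R" by (simp add: elem eq[of a b])
    qed
    show "(\<lambda>Q. the_elem (f ` Q)) ` ((\<lambda>a. (\<lambda>j. a + j) ` J) ` carr A) = carr X"
      by (subst image_image, subst surj[symmetric], rule image_cong) (simp_all only: elem)
  qed
qed

section \<open>Sweedler sums\<close>

text \<open>The ambient space of all tensor products: a target with full carrier, so that linearity into it
  carries no membership condition.\<close>
definition funsp :: "('k::field, 'i \<Rightarrow> 'k) vs" where
  "funsp = \<lparr>carr = UNIV, scl = tscale\<rparr>"

lemma funsp [simp]: "carr funsp = UNIV" "scl funsp = tscale"
  by (simp_all add: funsp_def)

lemma vspace_funsp [simp]: "vspace funsp"
  by (simp add: vspace_def vector_space_tscale ts.subspace_UNIV)

text \<open>The left coideal \<open>M\<close> is a parameter of the Sweedler calculus because a coproduct \<open>\<Delta>(m)\<close> with \<open>m \<in> M\<close>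
  has to be expanded in \<open>P \<otimes> M\<close>.\<close>
locale hopf_coideal =
  fixes P :: "('k::field, 'p::ring_1, 'z) hopf_scheme" and M :: "'p set"
  assumes hopf: "hopf_algebra P"
    and coideal: "m \<in> M \<Longrightarrow> comul P m \<in> carr (P \<otimes> sub P M)"
begin

abbreviation S where "S \<equiv> antipode P"
abbreviation eps where "eps \<equiv> counit P"

lemma vspace_P [simp]: "vspace P" and carr_P [simp]: "carr P = UNIV"
  and lin_comul: "lin P (P \<otimes> P) (comul P)" and lin_S: "lin P P S"
  and lin_eps: "lin P ground eps"
  and P_scale [simp]: "scl P c x * y = scl P c (x * y)" "x * scl P c y = scl P c (x * y)"
  and comul_one: "comul P 1 = tens P P 1 1"
  and eps_one [simp]: "eps 1 = 1" and eps_mult [simp]: "eps (x * y) = eps x * eps y"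
  using hopf by (simp_all add: hopf_algebra_def algebra_def coalgebra_def bilin_def lin_def)

lemma P_smult [simp]: "scl P 1 x = x" "scl P 0 x = 0" "scl P c (x + y) = scl P c x + scl P c y"
  "scl P c 0 = 0" "scl P c (scl P d x) = scl P (c * d) x" "scl P (c + d) x = scl P c x + scl P d x"
proof -
  interpret vector_space "scl P" using vspace_P by (simp add: vspace_def)
  show "scl P 1 x = x" "scl P 0 x = 0" "scl P c (x + y) = scl P c x + scl P c y"
    "scl P c 0 = 0" "scl P c (scl P d x) = scl P (c * d) x" "scl P (c + d) x = scl P c x + scl P d x" by (simp_all add: scale_right_distrib scale_left_distrib)
qed

lemma S_lin [simp]: "S (x + y) = S x + S y" "S (scl P c x) = scl P c (S x)"
  using lin_S by (simp_all add: lin_def)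

lemma eps_lin [simp]: "eps (x + y) = eps x + eps y" "eps (scl P c x) = c * eps x"
  using lin_eps by (simp_all add: lin_def ground_def)

text \<open>A chosen expansion of the coproduct, with second legs in \<open>M\<close> whenever \<open>x\<close> is in \<open>M\<close>. Sums over it are
  independent of the choice as soon as the summand is bilinear (\<open>tlift_comul\<close>).\<close>
definition legs :: "'p \<Rightarrow> ('p \<times> 'p) list" where
  "legs x = (SOME ps. comul P x = (\<Sum>(a, b)\<leftarrow>ps. tens P P a b) \<and> (x \<in> M \<longrightarrow> set ps \<subseteq> UNIV \<times> M))"

definition sw :: "'p \<Rightarrow> ('p \<Rightarrow> 'p \<Rightarrow> 'x::ab_group_add) \<Rightarrow> 'x" where
  "sw x F = (\<Sum>p\<leftarrow>legs x. F (fst p) (snd p))"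

lemma legs: "comul P x = (\<Sum>(a, b)\<leftarrow>legs x. tens P P a b) \<and> (x \<in> M \<longrightarrow> set (legs x) \<subseteq> UNIV \<times> M)"
  unfolding legs_def
proof (rule someI_ex, cases "x \<in> M")
  case True
  from tensor_eq_sum_list[OF vspace_P coideal[OF True]]
  show "\<exists>ps. comul P x = (\<Sum>(a, b)\<leftarrow>ps. tens P P a b) \<and> (x \<in> M \<longrightarrow> set ps \<subseteq> UNIV \<times> M)"
    by (metis carr_P carr_sub tens_sub(2))
next
  case False
  have "comul P x \<in> carr (P \<otimes> P)" using lin_comul by (simp add: lin_def)
  from tensor_eq_sum_list[OF vspace_P this] False
  show "\<exists>ps. comul P x = (\<Sum>(a, b)\<leftarrow>ps. tens P P a b) \<and> (x \<in> M \<longrightarrow> set ps \<subseteq> UNIV \<times> M)"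
    by metis
qed

lemma comul_sw: "comul P x = sw x (tens P P)"
  using legs[of x] by (simp add: sw_def case_prod_unfold)

text \<open>The point of choosing the expansion in \<open>P \<otimes> M\<close>: second legs inherit membership in \<open>M\<close>, also under
  iterated coproducts.\<close>
lemma sw_cong:
  "x \<in> M \<Longrightarrow> (\<And>a b. b \<in> M \<Longrightarrow> F a b = G a b) \<Longrightarrow> sw x F = sw x G"
  unfolding sw_def using legs[of x] by (intro arg_cong[where f = sum_list] map_cong) auto

lemma sw_in: "vspace A \<Longrightarrow> (\<And>a b. F a b \<in> carr A) \<Longrightarrow> sw x F \<in> carr A"
  unfolding sw_def by (intro vspace_sum_list) auto

lemma sw_in_coideal:
  "vspace A \<Longrightarrow> x \<in> M \<Longrightarrow> (\<And>a b. b \<in> M \<Longrightarrow> F a b \<in> carr A) \<Longrightarrow> sw x F \<in> carr A"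
  unfolding sw_def using legs[of x] by (intro vspace_sum_list) auto

lemma lin_sw:
  "vspace A \<Longrightarrow> lin A X f \<Longrightarrow> (\<And>a b. F a b \<in> carr A) \<Longrightarrow> f (sw x F) = sw x (\<lambda>a b. f (F a b))"
  unfolding sw_def by (subst lin_sum_list[of A X f]) (auto simp: case_prod_unfold)

lemma sw_swap: "sw x (\<lambda>a b. sw y (F a b)) = sw y (\<lambda>c d. sw x (\<lambda>a b. F a b c d))"
proof -
  have "(\<Sum>p\<leftarrow>ps. \<Sum>q\<leftarrow>qs. f p q) = (\<Sum>q\<leftarrow>qs. \<Sum>p\<leftarrow>ps. f p q )" for f :: "'p \<times> 'p \<Rightarrow> 'p \<times> 'p \<Rightarrow> 'c::ab_group_add" and ps qs
    by (induction ps) (simp_all add: sum_list_addf)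
  from this[of "\<lambda>p q. F (fst p) (snd p) (fst q) (snd q)"] show ?thesis
    unfolding sw_def by (simp add: case_prod_unfold)
qed

lemma sw_plus [simp]: "sw x (\<lambda>a b. F a b + G a b) = sw x F + sw x G"
  unfolding sw_def by (simp add: case_prod_unfold sum_list_addf)

lemma sw_scale_P [simp]: "sw x (\<lambda>a b. scl P c (F a b)) = scl P c (sw x F)"
  by (rule lin_sw[of P P "scl P c", symmetric]) (simp_all add: lin_def mult.commute)

lemma sw_tscale [simp]: "sw x (\<lambda>a b. tscale c (F a b)) = tscale c (sw x F)"
  by (rule lin_sw[of funsp funsp "tscale c", symmetric])
    (simp_all add: lin_def ts.scale_right_distrib mult.commute)

lemma sw_zero [simp]: "sw x (\<lambda>a b. 0) = 0"
  using sw_plus[of x "\<lambda>a b. 0" "\<lambda>a b. 0"] by simp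

lemma sw_minus: "sw x (\<lambda>a b. F a b - G a b) = sw x F - sw x G"
  using sw_plus[of x "\<lambda>a b. F a b - G a b" G] by (simp add: eq_diff_eq)

lemma sw_mult_left: "(y::'p) * sw x F = sw x (\<lambda>a b. y * F a b)"
  and sw_mult_right: "sw x F * y = sw x (\<lambda>a b. F a b * y)"
  using lin_sw[OF vspace_P, of P "(*) y" F x] lin_sw[OF vspace_P, of P "\<lambda>z. z * y" F x]
  by (simp_all add: lin_def distrib_left distrib_right)

lemma tlift_comul:
  assumes "vspace X" "bilin P P X \<beta>"
  shows "tlift P P \<beta> (comul P x) = sw x \<beta>"
  using tlift_sum_list[OF vspace_P vspace_P assms, of "legs x"] legs[of x] by (simp add: sw_def case_prod_unfold)

lemma lin_sw_arg:
  assumes "vspace X" "bilin P P X \<beta>"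
  shows "lin P X (\<lambda>x. sw x \<beta>)"
  using lin_compose[OF lin_comul tlift_universal(1)[OF vspace_P vspace_P assms]] assms
  by (simp add: tlift_comul)

lemma sw_arg_P [simp]:
  assumes "bilin P P P \<beta>"
  shows "sw (x + y) \<beta> = sw x \<beta> + sw y \<beta>" "sw (scl P c x) \<beta> = scl P c (sw x \<beta>)"
  using lin_sw_arg[OF vspace_P assms] by (simp_all add: lin_def)

lemma sw_arg_funsp [simp]:
  assumes "bilin P P funsp \<beta>"
  shows "sw (x + y) \<beta> = sw x \<beta> + sw y \<beta>" "sw (scl P c x) \<beta> = tscale c (sw x \<beta>)"
  using lin_sw_arg[OF vspace_funsp assms] by (simp_all add: lin_def)

text \<open>Unfolds linearity to equations that rewriting proves for the multilinear expressions below.\<close>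
lemmas linear_simps = bilin_def lin_def distrib_left distrib_right tens_bilinear tens_linear_fun

lemma sw_one: "bilin P P funsp \<beta> \<Longrightarrow> sw 1 \<beta> = \<beta> 1 1"
  using tlift_comul[of funsp \<beta> 1] tlift_universal(2)[of P P funsp \<beta> 1 1] by (simp add: comul_one)

lemma sw_counit_left:
  assumes "vspace X" "lin P X f"
  shows "sw x (\<lambda>a b. scl X (eps a) (f b)) = f x"
proof -
  have "tlift P P (\<lambda>a b. scl P (eps a) b) (comul P x) = x"
    using hopf by (simp add: hopf_algebra_def coalgebra_def)
  moreover have "bilin P P P (\<lambda>a b. scl P (eps a) b)"
    by (simp add: linear_simps mult.commute)
  ultimately have "sw x (\<lambda>a b. scl P (eps a) b) = x" by (simp add: tlift_comul[OF vspace_P])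
  then have "f x = f (sw x (\<lambda>a b. scl P (eps a) b))" by simp
  also have "\<dots> = sw x (\<lambda>a b. scl X (eps a) (f b))"
    using assms(2) by (subst lin_sw[OF vspace_P assms(2)]) (auto simp: lin_def)
  finally show ?thesis ..
qed

lemma sw_counit_right:
  assumes "vspace X" "lin P X f"
  shows "sw x (\<lambda>a b. scl X (eps b) (f a)) = f x"
proof -
  have "tlift P P (\<lambda>a b. scl P (eps b) a) (comul P x) = x"
    using hopf by (simp add: hopf_algebra_def coalgebra_def)
  moreover have "bilin P P P (\<lambda>a b. scl P (eps b) a)"
    by (simp add: linear_simps mult.commute)
  ultimately have "sw x (\<lambda>a b. scl P (eps b) a) = x" by (simp add: tlift_comul[OF vspace_P])
  then have "f x = f (sw x (\<lambda>a b. scl P (eps b) a))" by simp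
  also have "\<dots> = sw x (\<lambda>a b. scl X (eps b) (f a))"
    using assms(2) by (subst lin_sw[OF vspace_P assms(2)]) (auto simp: lin_def)
  finally show ?thesis ..
qed

lemma bilin_mult: "bilin P P P (*)"
  by (simp add: linear_simps)

lemma mult_map_tens: "mult_map P (tens P P x y) = x * y"
  and lin_mult_map: "lin (P \<otimes> P) P (mult_map P)"
  unfolding mult_map_def using tlift_universal[OF vspace_P vspace_P vspace_P bilin_mult] by simp_all

lemma tmap_comul:
  "lin P A f \<Longrightarrow> lin P B g \<Longrightarrow> tmap P P A B f g (comul P x) = sw x (\<lambda>a b. tens A B (f a) (g b))"
  unfolding tmap_def by (rule tlift_comul[OF vspace_tensor bilin_tens_compose])

lemma antipode_left: "sw x (\<lambda>a b. S a * b) = scl P (eps x) 1"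
  and antipode_right: "sw x (\<lambda>a b. a * S b) = scl P (eps x) 1"
proof -
  have "mult_map P (tmap P P P P S id (comul P x)) = scl P (eps x) 1"
    "mult_map P (tmap P P P P id S (comul P x)) = scl P (eps x) 1"
    using hopf by (simp_all add: hopf_algebra_def)
  then show "sw x (\<lambda>a b. S a * b) = scl P (eps x) 1" "sw x (\<lambda>a b. a * S b) = scl P (eps x) 1"
    by (simp_all add: tmap_comul lin_S lin_id tens_in_tensor mult_map_tens
        lin_sw[OF vspace_tensor lin_mult_map])
qed

text \<open>Both sides are the images of the two sides of the coassociativity axiom under the linear map
  \<open>P \<otimes> (P \<otimes> P) \<rightarrow> X\<close> induced by the trilinear \<open>\<tau>\<close>.\<close>
lemma sw_coassoc:
  assumes X: "vspace X" and \<tau>: "\<And>a. bilin P P X (\<tau> a)" "\<And>b c. lin P X (\<lambda>a. \<tau> a b c)"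
  shows "sw x (\<lambda>a b. sw a (\<lambda>c d. \<tau> c d b)) = sw x (\<lambda>a b. sw b (\<lambda>c d. \<tau> a c d))"
proof -
  let ?T = "tlift P (P \<otimes> P) (\<lambda>a t. tlift P P (\<tau> a) t)"
  have "bilin P (P \<otimes> P) X (\<lambda>a t. tlift P P (\<tau> a) t)"
    using assms by (intro tlift_bilin_right) auto
  note U = tlift_universal[OF vspace_P vspace_tensor X this]
  have T: "?T (tens P (P \<otimes> P) a (tens P P b c)) = \<tau> a b c" for a b c
    using U(2) tlift_universal(2)[OF vspace_P vspace_P X \<tau>(1)] by (simp add: tens_in_tensor)
  have push: "tens (P \<otimes> P) P (comul P a) b = sw a (\<lambda>c d. tens (P \<otimes> P) P (tens P P c d) b)"
    "tens P (P \<otimes> P) b (comul P a) = sw a (\<lambda>c d. tens P (P \<otimes> P) b (tens P P c d))" for a b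
    unfolding comul_sw
    using lin_sw[OF vspace_tensor[of P P], of "(P \<otimes> P) \<otimes> P" "\<lambda>t. tens (P \<otimes> P) P t b" "tens P P" a]
      lin_sw[OF vspace_tensor[of P P], of "P \<otimes> (P \<otimes> P)" "\<lambda>t. tens P (P \<otimes> P) b t" "tens P P" a]
      bilin_tens[of "P \<otimes> P" P] bilin_tens[of P "P \<otimes> P"]
    by (simp_all add: bilin_def tens_in_tensor)
  have "assoc_r P P P (tmap P P (P \<otimes> P) P (comul P) id (comul P x)) =
      tmap P P P (P \<otimes> P) id (comul P) (comul P x)"
    using hopf by (simp add: hopf_algebra_def coalgebra_def)
  then have "sw x (\<lambda>a b. sw a (\<lambda>c d. tens P (P \<otimes> P) c (tens P P d b))) =
      sw x (\<lambda>a b. sw b (\<lambda>c d. tens P (P \<otimes> P) a (tens P P c d)))"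
    by (simp add: tmap_comul lin_comul lin_id push tens_in_tensor sw_in[OF vspace_tensor]
        assoc_r_tens lin_sw[OF vspace_tensor lin_assoc_r])
  then have "?T (sw x (\<lambda>a b. sw a (\<lambda>c d. tens P (P \<otimes> P) c (tens P P d b)))) =
      ?T (sw x (\<lambda>a b. sw b (\<lambda>c d. tens P (P \<otimes> P) a (tens P P c d))))" by simp
  then show ?thesis
    by (simp add: lin_sw[OF vspace_tensor U(1)] sw_in[OF vspace_tensor] tens_in_tensor T)
qed

lemma sw_mult:
  assumes X: "vspace X" and \<beta>: "bilin P P X \<beta>"
  shows "sw (x * y) \<beta> = sw x (\<lambda>a b. sw y (\<lambda>c d. \<beta> (a * c) (b * d)))"
proof -
  have bilin: "bilin P P (P \<otimes> P) (\<lambda>c d. tens P P (a * c) (b * d))" for a b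
    by (simp add: linear_simps tens_in_tensor)
  have bilin': "bilin P P (P \<otimes> P) (\<lambda>a b. sw y (\<lambda>c d. tens P P (a * c) (b * d)))" for y
    by (simp add: linear_simps sw_in[OF vspace_tensor] tens_in_tensor)
  have "comul P (x * y) = tensor_mult P (comul P x) (comul P y)"
    using hopf by (simp add: hopf_algebra_def)
  also have "\<dots> = sw x (\<lambda>a b. sw y (\<lambda>c d. tens P P (a * c) (b * d)))"
    unfolding tensor_mult_def
    by (simp add: tlift_comul[OF vspace_tensor bilin] tlift_comul[OF vspace_tensor bilin'])
  finally have "tlift P P \<beta> (comul P (x * y)) =
      tlift P P \<beta> (sw x (\<lambda>a b. sw y (\<lambda>c d. tens P P (a * c) (b * d))))" by simp
  then show ?thesis
    by (simp add: tlift_comul[OF X \<beta>] lin_sw[OF vspace_tensor tlift_universal(1)[OF vspace_P vspace_P X \<beta>]]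
        sw_in[OF vspace_tensor] tens_in_tensor tlift_universal(2)[OF vspace_P vspace_P X \<beta>])
qed

lemma tens_sw [simp]:
  "vspace A \<Longrightarrow> tens A B (sw x F) b = sw x (\<lambda>a c. tens A B (F a c) b)"
  "vspace B \<Longrightarrow> tens A B a (sw x G) = sw x (\<lambda>b c. tens A B a (G b c))"
proof -
  have l: "lin (ambient A) funsp (\<lambda>a. tens A B a b)" "lin (ambient B) funsp (\<lambda>b. tens A B a b)"
    unfolding lin_def scl_ambient funsp by (auto simp only: tens_bilinear carr_ambient funsp UNIV_I)
  show "vspace A \<Longrightarrow> tens A B (sw x F) b = sw x (\<lambda>a c. tens A B (F a c) b)"
    by (rule lin_sw[OF vspace_ambient l(1)]) simp_all
  show "vspace B \<Longrightarrow> tens A B a (sw x G) = sw x (\<lambda>b c. tens A B a (G b c))"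
    by (rule lin_sw[OF vspace_ambient l(2)]) simp_all
qed

lemma tens_sw_fun: "vspace A \<Longrightarrow> tens A B (sw x F) = (\<lambda>b. sw x (\<lambda>a c. tens A B (F a c) b))"
  by (rule ext) simp

lemma tmap_sw:
  "vspace A \<Longrightarrow> vspace B \<Longrightarrow> lin A A' f \<Longrightarrow> lin B B' g \<Longrightarrow> (\<And>a b. F a b \<in> carr (A \<otimes> B)) \<Longrightarrow>
   tmap A B A' B' f g (sw x F) = sw x (\<lambda>a b. tmap A B A' B' f g (F a b))"
  by (rule lin_sw[OF vspace_tensor lin_tmap])

lemma assoc_sw:
  assumes "vspace A" "vspace B" "vspace D"
  shows "(\<And>a b. F a b \<in> carr ((A \<otimes> B) \<otimes> D)) \<Longrightarrow> assoc_r A B D (sw x F) = sw x (\<lambda>a b. assoc_r A B D (F a b))"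
    and "(\<And>a b. G a b \<in> carr (A \<otimes> (B \<otimes> D))) \<Longrightarrow> assoc_l A B D (sw x G) = sw x (\<lambda>a b. assoc_l A B D (G a b))"
  using lin_sw[OF vspace_tensor lin_assoc_r[OF assms]] lin_sw[OF vspace_tensor lin_assoc_l[OF assms]] by auto

section \<open>Antipode identities\<close>

text \<open>This lemma and the next say that \<open>u \<otimes> v \<mapsto> u v\<^sub>1 \<otimes> v\<^sub>2\<close> and \<open>u \<otimes> v \<mapsto> u S(v\<^sub>1) \<otimes> v\<^sub>2\<close> are mutually
  inverse, composed with a bilinear \<open>\<beta>\<close>: \<open>S(v\<^sub>1) v\<^sub>2 \<otimes> v\<^sub>3 = 1 \<otimes> v = v\<^sub>1 S(v\<^sub>2) \<otimes> v\<^sub>3\<close>.\<close>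
lemma sw_antipode_left:
  assumes \<beta>: "bilin P P funsp \<beta>"
  shows "sw v (\<lambda>a b. sw b (\<lambda>c d. \<beta> (S a * c) d)) = \<beta> 1 v"
proof -
  have lin: "\<beta> (x + y) z = \<beta> x z + \<beta> y z" "\<beta> x (y + z) = \<beta> x y + \<beta> x z"
    "\<beta> (scl P c x) z = tscale c (\<beta> x z)" "\<beta> x (scl P c z) = tscale c (\<beta> x z)" for x y z c
    using \<beta> by (simp_all add: bilin_def lin_def)
  have "sw v (\<lambda>a b. sw b (\<lambda>c d. \<beta> (S a * c) d)) = sw v (\<lambda>a b. sw a (\<lambda>c d. \<beta> (S c * d) b))"
    by (rule sw_coassoc[OF vspace_funsp, symmetric]) (simp_all add: linear_simps lin)
  also have "\<dots> = sw v (\<lambda>a b. \<beta> (sw a (\<lambda>c d. S c * d)) b)"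
    by (subst lin_sw[OF vspace_P, where X = funsp]) (simp_all add: lin_def lin)
  also have "\<dots> = sw v (\<lambda>a b. tscale (eps a) (\<beta> 1 b))"
    by (simp add: antipode_left lin)
  also have "\<dots> = \<beta> 1 v"
    using sw_counit_left[of funsp "\<beta> 1" v] by (simp add: lin_def lin)
  finally show ?thesis .
qed

lemma sw_antipode_right:
  assumes \<beta>: "bilin P P funsp \<beta>"
  shows "sw v (\<lambda>a b. sw b (\<lambda>c d. \<beta> (a * S c) d)) = \<beta> 1 v"
proof -
  have lin: "\<beta> (x + y) z = \<beta> x z + \<beta> y z" "\<beta> x (y + z) = \<beta> x y + \<beta> x z"
    "\<beta> (scl P c x) z = tscale c (\<beta> x z)" "\<beta> x (scl P c z) = tscale c (\<beta> x z)" for x y z c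
    using \<beta> by (simp_all add: bilin_def lin_def)
  have "sw v (\<lambda>a b. sw b (\<lambda>c d. \<beta> (a * S c) d)) = sw v (\<lambda>a b. sw a (\<lambda>c d. \<beta> (c * S d) b))"
    by (rule sw_coassoc[OF vspace_funsp, symmetric]) (simp_all add: linear_simps lin)
  also have "\<dots> = sw v (\<lambda>a b. \<beta> (sw a (\<lambda>c d. c * S d)) b)"
    by (subst lin_sw[OF vspace_P, where X = funsp]) (simp_all add: lin_def lin)
  also have "\<dots> = sw v (\<lambda>a b. tscale (eps a) (\<beta> 1 b))"
    by (simp add: antipode_right lin)
  also have "\<dots> = \<beta> 1 v"
    using sw_counit_left[of funsp "\<beta> 1" v] by (simp add: lin_def lin)
  finally show ?thesis .
qed

text \<open>Insert \<open>p\<^sub>2 S(p\<^sub>3)\<close>: \<open>S(m\<^sub>1 p) m\<^sub>2 = S(m\<^sub>1 p\<^sub>1) m\<^sub>2 p\<^sub>2 S(p\<^sub>3) = S((mp\<^sub>1)\<^sub>1) (mp\<^sub>1)\<^sub>2 S(p\<^sub>2)\<close>, and the first two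
  factors collapse to \<open>\<epsilon>(m p\<^sub>1)\<close>.\<close>
lemma antipode_mult_absorb: "sw m (\<lambda>a b. S (a * p) * b) = scl P (eps m) (S p)"
proof -
  have "sw m (\<lambda>a b. S (a * p) * b) = sw m (\<lambda>a b. sw p (\<lambda>c d. scl P (eps d) (S (a * c) * b)))"
    using sw_counit_right[of P "\<lambda>c. S (a * c) * b" p for a b] by (simp add: linear_simps)
  also have "\<dots> = sw m (\<lambda>a b. sw p (\<lambda>c d. sw d (\<lambda>e f. S (a * c) * b * (e * S f))))"
    by (simp add: antipode_right flip: sw_mult_left)
  also have "\<dots> = sw m (\<lambda>a b. sw p (\<lambda>x f. sw x (\<lambda>c e. S (a * c) * b * (e * S f))))"
    by (subst sw_coassoc[OF vspace_P]) (simp_all add: linear_simps)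
  also have "\<dots> = sw p (\<lambda>x f. sw m (\<lambda>a b. sw x (\<lambda>c e. S (a * c) * (b * e))) * S f)"
    by (subst sw_swap) (simp add: sw_mult_right mult.assoc)
  also have "\<dots> = sw p (\<lambda>x f. sw (m * x) (\<lambda>u v. S u * v) * S f)"
    by (subst sw_mult[OF vspace_P]) (simp_all add: linear_simps)
  also have "\<dots> = scl P (eps m) (sw p (\<lambda>x f. scl P (eps x) (S f)))"
    by (simp add: antipode_left flip: sw_scale_P)
  also have "\<dots> = scl P (eps m) (S p)"
    using sw_counit_left[OF vspace_P lin_S] by simp
  finally show ?thesis .
qed

text \<open>The identity \<open>(S v\<^sub>2)\<^sub>1 \<otimes> v\<^sub>1 (S v\<^sub>2)\<^sub>2 = S(v) \<otimes> 1\<close>, dual to the previous one.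
  Multiply the first leg by \<open>S(v\<^sub>1) v\<^sub>2\<close> to turn the left side into
  \<open>(S(v\<^sub>1) \<otimes> 1) \<Delta>(v\<^sub>2) \<Delta>(S v\<^sub>3) = (S(v\<^sub>1) \<otimes> 1) \<Delta>(v\<^sub>2 S(v\<^sub>3))\<close>.\<close>
lemma antipode_comul_absorb:
  assumes \<beta>: "bilin P P funsp \<beta>"
  shows "sw v (\<lambda>a b. sw (S b) (\<lambda>c d. \<beta> c (a * d))) = \<beta> (S v) 1"
proof -
  have lin: "\<beta> (x + y) z = \<beta> x z + \<beta> y z" "\<beta> x (y + z) = \<beta> x y + \<beta> x z"
    "\<beta> (scl P c x) z = tscale c (\<beta> x z)" "\<beta> x (scl P c z) = tscale c (\<beta> x z)" for x y z c
    using \<beta> by (simp_all add: bilin_def lin_def)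
  have lin': "\<beta> (x + y) = (\<lambda>z. \<beta> x z + \<beta> y z)" "\<beta> (scl P c x) = (\<lambda>z. tscale c (\<beta> x z))" for x y c
    by (simp_all add: lin fun_eq_iff[of "\<beta> _"])
  have "sw v (\<lambda>a b. sw (S b) (\<lambda>c d. \<beta> c (a * d))) =
      sw v (\<lambda>a b. sw a (\<lambda>a1 a2. tscale (eps a1) (sw (S b) (\<lambda>c d. \<beta> c (a2 * d)))))"
    using sw_counit_left[of funsp "\<lambda>a. sw (S b) (\<lambda>c d. \<beta> c (a * d))" for b]
    by (simp add: linear_simps lin)
  also have "\<dots> = sw v (\<lambda>a b. sw a (\<lambda>a1 a2. sw (S b) (\<lambda>c d. \<beta> (sw a1 (\<lambda>x y. S x * y) * c) (a2 * d))))"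
    by (simp add: antipode_left lin)
  also have "\<dots> = sw v (\<lambda>a b. sw a (\<lambda>a1 a2. sw (S b) (\<lambda>c d. sw a1 (\<lambda>x y. \<beta> (S x * (y * c)) (a2 * d)))))"
    by (subst lin_sw[OF vspace_P, where X = funsp and f = "\<lambda>x. \<beta> (x * _) _"]) (simp_all add: linear_simps lin mult.assoc)
  also have "\<dots> = sw v (\<lambda>a b. sw a (\<lambda>a1 a2. sw a1 (\<lambda>x y. sw (S b) (\<lambda>c d. \<beta> (S x * (y * c)) (a2 * d)))))"
    by (subst sw_swap) simp
  also have "\<dots> = sw v (\<lambda>a b. sw a (\<lambda>x w. sw w (\<lambda>y z. sw (S b) (\<lambda>c d. \<beta> (S x * (y * c)) (z * d)))))"
    by (subst sw_coassoc[OF vspace_funsp]) (simp_all add: linear_simps lin)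
  also have "\<dots> = sw v (\<lambda>a b. sw a (\<lambda>x w. sw (w * S b) (\<lambda>c d. \<beta> (S x * c) d)))"
    by (subst sw_mult[OF vspace_funsp]) (simp_all add: linear_simps lin)
  also have "\<dots> = sw v (\<lambda>x u. sw u (\<lambda>w b. sw (w * S b) (\<lambda>c d. \<beta> (S x * c) d)))"
    by (rule sw_coassoc[OF vspace_funsp]) (simp_all add: linear_simps lin lin')
  also have "\<dots> = sw v (\<lambda>x u. sw (sw u (\<lambda>w b. w * S b)) (\<lambda>c d. \<beta> (S x * c) d))"
    by (subst lin_sw[OF vspace_P lin_sw_arg[OF vspace_funsp]]) (simp_all add: linear_simps lin)
  also have "\<dots> = sw v (\<lambda>x u. tscale (eps u) (\<beta> (S x) 1))"
    by (simp add: antipode_right linear_simps lin sw_one)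
  also have "\<dots> = \<beta> (S v) 1"
    using sw_counit_right[of funsp "\<lambda>x. \<beta> (S x) 1"] by (simp add: linear_simps lin)
  finally show ?thesis .
qed

end

section \<open>Quantum embeddable homogeneous spaces\<close>

locale embeddable_space =
  fixes P :: "('k::field, 'p::ring_1, 'y) hopf_scheme" and M :: "'p set"
    and C :: "('k, 'c::ab_group_add, 'z) coalg_scheme" and \<pi> :: "'p \<Rightarrow> 'c"
  assumes space: "quantum_embeddable_homogeneous_space P M C \<pi>"

sublocale embeddable_space \<subseteq> hopf_coideal P M
  by unfold_locales (use space in \<open>unfold quantum_embeddable_homogeneous_space_def, blast+\<close>)

context embeddable_space
begin

abbreviation W where "W \<equiv> module.span (scl P) {m * p | m p. m \<in> augmentation P M}"
abbreviation V where "V \<equiv> sub P (augmentation P M)"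
abbreviation \<psi> where "\<psi> \<equiv> canonical_entwining P C \<pi>"
abbreviation coactR where "coactR \<equiv> right_coaction P C \<pi>"
abbreviation coactL where "coactL \<equiv> \<lambda>v. tmap P P C P \<pi> id (comul P v)"
abbreviation \<theta> where "\<theta> \<equiv> \<lambda>v. tmap P P P P S id (comul P v)"

lemma quotient: "quotient_coalgebra P W C \<pi>"
  and subalgebra_M: "subalgebra P M"
  and coinvariants: "M = {u. coactR u = tens P C u (\<pi> 1)}"
  using space unfolding quantum_embeddable_homogeneous_space_def by blast+

lemma coalgebra_C: "coalgebra C" and vspace_C [simp]: "vspace C" and lin_pi: "lin P C \<pi>"
  and lin_comul_C: "lin C (C \<otimes> C) (comul C)" and lin_counit_C: "lin C ground (counit C)"
  and range_pi: "range \<pi> = carr C" and ker_pi: "{p. \<pi> p = 0} = W"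
  and pi_in [simp]: "\<pi> x \<in> carr C"
  and pi_lin [simp]: "\<pi> (x + y) = \<pi> x + \<pi> y" "\<pi> (scl P c x) = scl C c (\<pi> x)"
  and counit_pi [simp]: "counit C (\<pi> x) = eps x"
  using quotient by (simp_all add: quotient_coalgebra_def coalgebra_def lin_def)

lemma comul_pi: "comul C (\<pi> x) = sw x (\<lambda>a b. tens C C (\<pi> a) (\<pi> b))"
  using quotient by (simp add: quotient_coalgebra_def tmap_comul lin_pi)

lemma subspace_M: "module.subspace (scl P) M" and one_in_M: "1 \<in> M"
  and mult_in_M: "x \<in> M \<Longrightarrow> y \<in> M \<Longrightarrow> x * y \<in> M"
  using subalgebra_M by (simp_all add: subalgebra_def)

lemma vspace_M: "vspace (sub P M)"
  by (rule vspace_sub[OF vspace_P subspace_M])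

lemma coactR_sw: "coactR u = sw u (\<lambda>a b. tens P C a (\<pi> b))"
  unfolding right_coaction_def by (simp add: tmap_comul lin_id lin_pi)

lemma coactL_sw: "coactL u = sw u (\<lambda>a b. tens C P (\<pi> a) b)"
  by (simp add: tmap_comul lin_id lin_pi)

lemma theta_sw: "\<theta> u = sw u (\<lambda>a b. tens P P (S a) b)"
  by (simp add: tmap_comul lin_id lin_S)

text \<open>Since \<open>m - \<epsilon>(m) 1\<close> is in \<open>M\<^sup>+\<close>.\<close>
lemma pi_M_mult:
  assumes m: "m \<in> M"
  shows "\<pi> (m * x) = scl C (eps m) (\<pi> x)"
proof -
  interpret vector_space "scl P" using vspace_P by (simp add: vspace_def)
  have "m - scl P (eps m) 1 \<in> M"
    using vspace_diff[OF vspace_M, of m "scl P (eps m) 1"] vspace_scale[OF vspace_M, of 1 "eps m"] m one_in_M by simp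
  moreover have "eps (m - scl P (eps m) 1) = 0"
    using eps_lin(1)[of "m - scl P (eps m) 1" "scl P (eps m) 1"] by simp
  ultimately have "(m - scl P (eps m) 1) * x \<in> W"
    by (intro span_base) (auto simp: augmentation_def)
  then have "\<pi> ((m - scl P (eps m) 1) * x) = 0" using ker_pi by blast
  moreover have "m * x = (m - scl P (eps m) 1) * x + scl P (eps m) x" by (simp add: left_diff_distrib)
  ultimately show ?thesis by (metis add_0 pi_lin)
qed

lemma lin_psi: "lin (C \<otimes> P) (P \<otimes> C) \<psi>"
  using canonical_entwining_tens(1)[OF space] .

lemma psi_tens: "\<psi> (tens C P (\<pi> g) h) = sw h (\<lambda>a b. tens P C a (\<pi> (g * b)))"
proof -
  have "lin P C (\<lambda>x. \<pi> (g * x))" by (simp add: linear_simps)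
  then show ?thesis using canonical_entwining_tens(2)[OF space, of g h] by (simp add: tmap_comul lin_id)
qed

lemma psi_sw: "(\<And>a b. F a b \<in> carr (C \<otimes> P)) \<Longrightarrow> \<psi> (sw x F) = sw x (\<lambda>a b. \<psi> (F a b))"
  by (rule lin_sw[OF vspace_tensor lin_psi])

text \<open>Evaluates composites of the structure maps on Sweedler sums of pure tensors. The rules have
  linearity side conditions, so they are kept apart from \<open>linear_simps\<close>, which unfolds linearity.\<close>
lemmas sweedler_simps = vspace_tensor tens_in_tensor sw_in lin_id lin_psi lin_pi lin_S lin_mult_map lin_comul_C
  tmap_tens tmap_sw assoc_r_tens assoc_l_tens assoc_sw psi_tens psi_sw comul_pi mult_map_tens

lemma lin_entwine2: "lin (C \<otimes> (P \<otimes> P)) ((P \<otimes> P) \<otimes> C) (entwine2 P C \<psi>)"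
  unfolding entwine2_def comp_def
  by (rule lin_compose[OF lin_compose[OF lin_compose[OF lin_compose[OF
      lin_assoc_l lin_tmap] lin_assoc_r] lin_tmap] lin_assoc_l])
    (simp_all add: vspace_tensor lin_id lin_psi)

lemma entwine2_tens:
  "entwine2 P C \<psi> (tens C (P \<otimes> P) (\<pi> g) (tens P P p q)) =
     sw p (\<lambda>a b. sw q (\<lambda>c d. tens (P \<otimes> P) C (tens P P a c) (\<pi> (g * b * d))))"
  by (simp add: entwine2_def sweedler_simps)

lemma entwining: "entwining_structure P C \<psi>"
  unfolding entwining_structure_def
proof (intro conjI ballI allI)
  show "algebra P" using hopf by (simp add: hopf_algebra_def)
  show "coalgebra C" by (rule coalgebra_C)
  show "lin (C \<otimes> P) (P \<otimes> C) \<psi>" by (rule lin_psi)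
next
  fix c assume "c \<in> carr C"
  then obtain g where c: "c = \<pi> g" using range_pi by blast
  show "\<psi> (tens C P c (p * q)) = tmap (P \<otimes> P) C P C (mult_map P) id
      (entwine2 P C \<psi> (tens C (P \<otimes> P) c (tens P P p q)))" for p q
  proof -
    have "\<psi> (tens C P c (p * q)) = sw p (\<lambda>a b. sw q (\<lambda>x d. tens P C (a * x) (\<pi> (g * (b * d)))))"
      unfolding c psi_tens by (rule sw_mult[OF vspace_funsp]) (simp add: linear_simps)
    then show ?thesis
      unfolding c entwine2_tens by (simp add: sweedler_simps mult.assoc)
  qed
  show "\<psi> (tens C P c 1) = tens P C 1 c"
    unfolding c psi_tens by (subst sw_one) (simp_all add: linear_simps)
  show "tmap P C P (C \<otimes> C) id (comul C) (\<psi> (tens C P c p)) =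
       assoc_r P C C (tmap (C \<otimes> P) C (P \<otimes> C) C \<psi> id (assoc_l C P C
         (tmap C (C \<otimes> P) C (P \<otimes> C) id \<psi> (assoc_r C C P (tens (C \<otimes> C) P (comul C c) p)))))"
    (is "?L = ?R") for p
  proof -
    have "?L = sw p (\<lambda>a b. sw (g * b) (\<lambda>x y. tens P (C \<otimes> C) a (tens C C (\<pi> x) (\<pi> y))))"
      unfolding c by (simp add: sweedler_simps)
    also have "\<dots> = sw p (\<lambda>a b. sw g (\<lambda>x y. sw b (\<lambda>u v. tens P (C \<otimes> C) a (tens C C (\<pi> (x * u)) (\<pi> (y * v))))))"
      by (subst sw_mult[OF vspace_funsp]) (simp_all add: linear_simps)
    also have "\<dots> = sw g (\<lambda>x y. sw p (\<lambda>a b. sw b (\<lambda>u v. tens P (C \<otimes> C) a (tens C C (\<pi> (x * u)) (\<pi> (y * v))))))"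
      by (rule sw_swap)
    also have "\<dots> = sw g (\<lambda>x y. sw p (\<lambda>a b. sw a (\<lambda>u v. tens P (C \<otimes> C) u (tens C C (\<pi> (x * v)) (\<pi> (y * b))))))"
      by (subst sw_coassoc[OF vspace_funsp]) (simp_all add: linear_simps)
    also have "\<dots> = ?R"
      unfolding c by (simp add: sweedler_simps)
    finally show ?thesis .
  qed
  show "tlift P C (\<lambda>x d. scl P (counit C d) x) (\<psi> (tens C P c p)) = scl P (counit C c) p" for p
  proof -
    have "bilin P C P (\<lambda>x d. scl P (counit C d) x)"
      using lin_counit_C by (simp add: linear_simps ground_def mult.commute)
    note U = tlift_universal(1,2)[OF vspace_P vspace_C vspace_P this]
    have "tlift P C (\<lambda>x d. scl P (counit C d) x) (\<psi> (tens C P c p)) = sw p (\<lambda>a b. scl P (eps g * eps b) a)"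
      unfolding c psi_tens by (subst lin_sw[OF vspace_tensor U(1)]) (simp_all add: tens_in_tensor U(2))
    also have "\<dots> = scl P (eps g) (sw p (\<lambda>a b. scl P (eps b) a))" by (simp flip: sw_scale_P)
    also have "\<dots> = scl P (eps g) p" using sw_counit_right[OF vspace_P lin_id, of p] by simp
    finally show ?thesis by (simp add: c)
  qed
qed

lemma grouplike_pi_one: "comul C (\<pi> 1) = tens C C (\<pi> 1) (\<pi> 1)" "counit C (\<pi> 1) = 1"
  by (simp_all add: comul_pi sw_one linear_simps)

lemma coactR_psi: "coactR u = \<psi> (tens C P (\<pi> 1) u)"
  by (simp add: psi_tens coactR_sw)

lemma lin_coactR: "lin P (P \<otimes> C) coactR"
  unfolding coactR_sw by (rule lin_sw_arg[OF vspace_tensor]) (simp add: linear_simps tens_in_tensor)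

lemma lin_coactL: "lin P (C \<otimes> P) coactL"
  unfolding coactL_sw by (rule lin_sw_arg[OF vspace_tensor]) (simp add: linear_simps tens_in_tensor)

lemma lin_theta: "lin P (P \<otimes> P) \<theta>"
  unfolding theta_sw by (rule lin_sw_arg[OF vspace_tensor]) (simp add: linear_simps tens_in_tensor)

text \<open>Left \<open>M\<close>-linearity of \<open>\<Delta>\<^sub>P\<close>: in \<open>m\<^sub>1 u\<^sub>1 \<otimes> \<pi>(m\<^sub>2 u\<^sub>2)\<close> the leg \<open>m\<^sub>2\<close> is in \<open>M\<close> and comes out as \<open>\<epsilon>(m\<^sub>2)\<close>.\<close>
lemma coactR_M_mult:
  assumes m: "m \<in> M"
  shows "coactR (m * u) = sw u (\<lambda>a b. tens P C (m * a) (\<pi> b))"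
proof -
  have "coactR (m * u) = sw m (\<lambda>a b. sw u (\<lambda>c d. tens P C (a * c) (\<pi> (b * d))))"
    unfolding coactR_sw by (rule sw_mult[OF vspace_funsp]) (simp add: linear_simps)
  also have "\<dots> = sw m (\<lambda>a b. tscale (eps b) (sw u (\<lambda>c d. tens P C (a * c) (\<pi> d))))"
    using m by (intro sw_cong) (simp_all add: pi_M_mult tens_bilinear)
  also have "\<dots> = sw u (\<lambda>a b. tens P C (m * a) (\<pi> b))"
    using sw_counit_right[of funsp "\<lambda>a. sw u (\<lambda>c d. tens P C (a * c) (\<pi> d))"] by (simp add: linear_simps)
  finally show ?thesis .
qed

lemma lin_lact: "vspace B \<Longrightarrow> lin (P \<otimes> B) (P \<otimes> B) (lact P B u)"
  and lact_tens: "vspace B \<Longrightarrow> b \<in> carr B \<Longrightarrow> lact P B u (tens P B a b) = tens P B (u * a) b"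
  and lact_sw: "vspace B \<Longrightarrow> (\<And>a b. F a b \<in> carr (P \<otimes> B)) \<Longrightarrow>
    lact P B u (sw x F) = sw x (\<lambda>a b. lact P B u (F a b))"
proof -
  have "lin P P (\<lambda>x. u * x)" by (simp add: linear_simps)
  then show *: "vspace B \<Longrightarrow> lin (P \<otimes> B) (P \<otimes> B) (lact P B u)"
    and "vspace B \<Longrightarrow> b \<in> carr B \<Longrightarrow> lact P B u (tens P B a b) = tens P B (u * a) b"
    unfolding lact_def by (simp_all add: lin_tmap tmap_tens lin_id)
  show "vspace B \<Longrightarrow> (\<And>a b. F a b \<in> carr (P \<otimes> B)) \<Longrightarrow>
    lact P B u (sw x F) = sw x (\<lambda>a b. lact P B u (F a b))"
    using lin_sw[OF vspace_tensor *] .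
qed

lemmas coaction_simps = sweedler_simps lact_tens lact_sw lin_coactR coactR_sw coactL_sw theta_sw


section \<open>The Galois map\<close>

text \<open>The map \<open>s\<close> on all of \<open>P \<otimes> P\<close>, and its inverse \<open>\<kappa>\<close>. The map \<open>s\<close> extends \<open>s\<^sub>\<theta>\<close>
  (\<open>frame_map_eq\<close>).\<close>
definition frame where "frame = tlift P P (\<lambda>u v. sw v (\<lambda>a b. tens P P (u * S a) b))"
definition coframe where "coframe = tlift P P (\<lambda>u v. sw v (\<lambda>a b. tens P P (u * a) b))"

lemma lin_frame: "lin (P \<otimes> P) (P \<otimes> P) frame"
  and frame_tens: "frame (tens P P u v) = sw v (\<lambda>a b. tens P P (u * S a) b)"
proof -
  have "bilin P P (P \<otimes> P) (\<lambda>u v. sw v (\<lambda>a b. tens P P (u * S a) b))"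
    by (simp add: linear_simps tens_in_tensor sw_in[OF vspace_tensor])
  from tlift_universal(1,2)[OF vspace_P vspace_P vspace_tensor this]
  show "lin (P \<otimes> P) (P \<otimes> P) frame" "frame (tens P P u v) = sw v (\<lambda>a b. tens P P (u * S a) b)"
    by (simp_all add: frame_def)
qed

lemma lin_coframe: "lin (P \<otimes> P) (P \<otimes> P) coframe"
  and coframe_tens: "coframe (tens P P u v) = sw v (\<lambda>a b. tens P P (u * a) b)"
proof -
  have "bilin P P (P \<otimes> P) (\<lambda>u v. sw v (\<lambda>a b. tens P P (u * a) b))"
    by (simp add: linear_simps tens_in_tensor sw_in[OF vspace_tensor])
  from tlift_universal(1,2)[OF vspace_P vspace_P vspace_tensor this]
  show "lin (P \<otimes> P) (P \<otimes> P) coframe" "coframe (tens P P u v) = sw v (\<lambda>a b. tens P P (u * a) b)"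
    by (simp_all add: coframe_def)
qed

lemmas frame_sw = lin_sw[OF vspace_tensor lin_frame] lin_sw[OF vspace_tensor lin_coframe]

lemma coframe_frame: "t \<in> carr (P \<otimes> P) \<Longrightarrow> coframe (frame t) = t"
proof (rule tensor_lin_eq[OF vspace_P lin_compose[OF lin_frame lin_coframe], where Y = "P \<otimes> P" and g = "\<lambda>t. t"])
  show "coframe (frame (tens P P u v)) = tens P P u v" for u v
    using sw_antipode_left[of "\<lambda>x y. tens P P (u * x) y" v]
    by (simp add: frame_tens coframe_tens frame_sw tens_in_tensor linear_simps mult.assoc)
qed (simp_all add: lin_def)

lemma frame_coframe: "t \<in> carr (P \<otimes> P) \<Longrightarrow> frame (coframe t) = t"
proof (rule tensor_lin_eq[OF vspace_P lin_compose[OF lin_coframe lin_frame], where Y = "P \<otimes> P" and g = "\<lambda>t. t"])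
  show "frame (coframe (tens P P u v)) = tens P P u v" for u v
    using sw_antipode_right[of "\<lambda>x y. tens P P (u * x) y" v]
    by (simp add: frame_tens coframe_tens frame_sw tens_in_tensor linear_simps mult.assoc)
qed (simp_all add: lin_def)

abbreviation galois where "galois \<equiv> galois_map P C coactR"

lemma lact_coactR: "lact P C u (coactR v) = sw v (\<lambda>a b. tens P C (u * a) (\<pi> b))"
  by (simp add: coaction_simps)

lemma lin_galois: "lin (P \<otimes> P) (P \<otimes> C) galois"
  and galois_tens: "galois (tens P P u v) = sw v (\<lambda>a b. tens P C (u * a) (\<pi> b))"
proof -
  have "bilin P P (P \<otimes> C) (\<lambda>u v. sw v (\<lambda>a b. tens P C (u * a) (\<pi> b)))"
    by (simp add: linear_simps tens_in_tensor sw_in[OF vspace_tensor])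
  from tlift_universal(1,2)[OF vspace_P vspace_P vspace_tensor this]
  show "lin (P \<otimes> P) (P \<otimes> C) galois"
    "galois (tens P P u v) = sw v (\<lambda>a b. tens P C (u * a) (\<pi> b))"
    by (simp_all add: galois_map_def lact_coactR)
qed

lemma galois_coframe: "t \<in> carr (P \<otimes> P) \<Longrightarrow> galois t = tmap P P P C id \<pi> (coframe t)"
  by (rule tensor_lin_eq[OF vspace_P lin_galois lin_compose[OF lin_coframe lin_tmap]])
    (simp_all add: galois_tens coframe_tens sweedler_simps)

text \<open>The canonical map respects the relation \<open>um \<otimes> v = u \<otimes> mv\<close> because \<open>\<Delta>\<^sub>P\<close> is left \<open>M\<close>-linear.\<close>
lemma balancing_subset: "balancing P M \<subseteq> {t \<in> carr (P \<otimes> P). galois t = 0}"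
  unfolding balancing_def
proof (rule ts.span_minimal)
  show "{tens P P (u * m) v - tens P P u (m * v) |u m v. m \<in> M} \<subseteq> {t \<in> carr (P \<otimes> P). galois t = 0}"
  proof safe
    fix u m v assume m: "m \<in> M"
    show in_t: "tens P P (u * m) v - tens P P u (m * v) \<in> carr (P \<otimes> P)"
      by (intro vspace_diff[OF vspace_tensor] tens_in_tensor) simp_all
    have "galois (tens P P u (m * v)) = lact P C u (coactR (m * v))"
      by (simp add: galois_tens lact_coactR)
    also have "\<dots> = galois (tens P P (u * m) v)"
      unfolding coactR_M_mult[OF m] by (simp add: galois_tens coaction_simps mult.assoc)
    finally show "galois (tens P P (u * m) v - tens P P u (m * v)) = 0"
      by (subst lin_diff[OF vspace_tensor lin_galois]) (simp_all add: tens_in_tensor)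
  qed
  show "ts.subspace {t \<in> carr (P \<otimes> P). galois t = 0}"
    using vspace_zero[OF vspace_tensor] vspace_add[OF vspace_tensor] vspace_scale[OF vspace_tensor, of _ P P]
    by (intro ts.subspaceI) (auto simp: lin_zero[OF vspace_tensor lin_galois] lin_add[OF lin_galois]
       lin_scale[OF lin_galois, simplified] )
qed

text \<open>A preimage of \<open>p \<otimes> \<pi>(g)\<close> is \<open>s(p \<otimes> g)\<close>.\<close>
lemma galois_surj: "galois ` carr (P \<otimes> P) = carr (P \<otimes> C)"
proof
  show "galois ` carr (P \<otimes> P) \<subseteq> carr (P \<otimes> C)" using lin_in[OF lin_galois] by blast
  show "carr (P \<otimes> C) \<subseteq> galois ` carr (P \<otimes> P)"
  proof
    fix t assume t: "t \<in> carr (P \<otimes> C)"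
    have "id t \<in> galois ` carr (P \<otimes> P)"
    proof (rule tensor_lin_into_subspace[OF vspace_P vspace_tensor lin_id t])
      show "module.subspace (scl (P \<otimes> C)) (galois ` carr (P \<otimes> P))"
        by (rule lin_image_subspace[OF vspace_tensor vspace_tensor lin_galois])
      fix p c assume "c \<in> carr C"
      then obtain g where g: "c = \<pi> g" using range_pi by blast
      have fr: "frame (tens P P p g) \<in> carr (P \<otimes> P)" by (simp add: lin_in[OF lin_frame] tens_in_tensor)
      then have "galois (frame (tens P P p g)) = tmap P P P C id \<pi> (coframe (frame (tens P P p g)))"
        by (rule galois_coframe)
      also have "\<dots> = tens P C p c"
        using coframe_frame[of "tens P P p g"] by (simp add: sweedler_simps g)
      finally show "id (tens P C p c) \<in> galois ` carr (P \<otimes> P)" using fr by (metis id_apply imageI)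
    qed
    then show "t \<in> galois ` carr (P \<otimes> P)" by simp
  qed
qed

lemma balancing_generator: "m \<in> M \<Longrightarrow> tens P P u (m * v) - tens P P (u * m) v \<in> balancing P M"
  unfolding balancing_def
  by (subst minus_diff_eq[symmetric], rule ts.span_neg, rule ts.span_base) blast

text \<open>On a generator \<open>m p\<close> of \<open>M\<^sup>+P\<close> the value is \<open>a S(m\<^sub>1 p\<^sub>1) \<otimes> m\<^sub>2 p\<^sub>2\<close>. Moving \<open>m\<^sub>2\<close>, which is in \<open>M\<close>, to the first
  leg changes it by an element of the balancing subspace and gives \<open>\<epsilon>(m) a S(p\<^sub>1) \<otimes> p\<^sub>2 = 0\<close>.\<close>
lemma frame_kernel:
  assumes w: "w \<in> W"
  shows "frame (tens P P a w) \<in> balancing P M"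
proof -
  interpret P: vector_space "scl P" using vspace_P by (simp add: vspace_def)
  have bal: "vspace (sub (P \<otimes> P) (balancing P M))"
    by (rule vspace_sub[OF vspace_tensor]) (simp add: balancing_def ts.subspace_span)
  have gen: "frame (tens P P a (m * p)) \<in> balancing P M" if m: "m \<in> M" "eps m = 0" for m p
  proof -
    have "frame (tens P P a (m * p)) =
        sw m (\<lambda>x y. sw p (\<lambda>c d. tens P P (a * S (x * c)) (y * d)))"
      unfolding frame_tens by (rule sw_mult[OF vspace_funsp]) (simp add: linear_simps)
    also have "sw m (\<lambda>x y. sw p (\<lambda>c d. tens P P (a * S (x * c) * y) d)) =
        sw p (\<lambda>c d. tens P P (a * sw m (\<lambda>x y. S (x * c) * y)) d)"
      by (subst sw_swap) (simp add: sw_mult_left mult.assoc tens_sw_fun)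
    then have "sw m (\<lambda>x y. sw p (\<lambda>c d. tens P P (a * S (x * c) * y) d)) = 0"
      by (simp add: antipode_mult_absorb m)
    then have "sw m (\<lambda>x y. sw p (\<lambda>c d. tens P P (a * S (x * c)) (y * d))) =
        sw m (\<lambda>x y. sw p (\<lambda>c d. tens P P (a * S (x * c)) (y * d) - tens P P (a * S (x * c) * y) d))"
      by (simp add: sw_minus)
    also have "\<dots> \<in> carr (sub (P \<otimes> P) (balancing P M))"
      by (intro sw_in_coideal[OF bal m(1)] sw_in[OF bal]) (simp add: balancing_generator)
    finally show ?thesis by simp
  qed
  have l: "lin P (P \<otimes> P) (\<lambda>w. frame (tens P P a w))"
    using lin_compose[OF _ lin_frame, of P "tens P P a"] bilin_tens[of P P] by (simp add: bilin_def)
  from w show ?thesis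
  proof (induction rule: P.span_induct_alt)
    case base
    show ?case unfolding lin_zero[OF vspace_P l] using vspace_zero[OF bal] by (simp only: carr_sub)
  next
    case (step c x y)
    then have "frame (tens P P a x) \<in> balancing P M" using gen by (auto simp: augmentation_def)
    have eq: "frame (tens P P a (scl P c x + y)) = tscale c (frame (tens P P a x)) + frame (tens P P a y)"
      using lin_add[OF l, of "scl P c x" y] lin_scale[OF l, of x c] by (simp del: tens_tscale)
    show ?case
      unfolding eq using step \<open>frame (tens P P a x) \<in> balancing P M\<close>
        vspace_add[OF bal, of "tscale c (frame (tens P P a x))" "frame (tens P P a y)"]
        vspace_scale[OF bal, of "frame (tens P P a x)" c]
      by (simp only: carr_sub scl_sub scl_tensor)
  qed
qed

text \<open>If \<open>(id \<otimes> \<pi>)(\<kappa> t) = 0\<close> then \<open>\<kappa> t \<in> P \<otimes> M\<^sup>+P\<close> by exactness, and \<open>t = s(\<kappa> t)\<close>.\<close>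
lemma galois_kernel:
  assumes t: "t \<in> carr (P \<otimes> P)" and t0: "galois t = 0"
  shows "t \<in> balancing P M"
proof -
  have "coframe t \<in> carr (P \<otimes> sub P {b \<in> carr P. \<pi> b = 0})"
    using t t0 by (intro tensor_kernel_right[OF vspace_P vspace_P vspace_C lin_pi])
      (simp_all add: lin_in[OF lin_coframe] galois_coframe)
  then have "coframe t \<in> carr (P \<otimes> sub P W)" by (simp add: ker_pi)
  then have "frame (coframe t) \<in> balancing P M"
  proof (rule tensor_lin_into_subspace[OF vspace_P vspace_tensor, rotated])
    show "lin (P \<otimes> sub P W) (P \<otimes> P) frame"
      by (rule lin_restrict[OF lin_frame tensor_mono]) simp_all
    show "module.subspace (scl (P \<otimes> P)) (balancing P M)"
      by (simp add: balancing_def ts.subspace_span)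
  qed (simp_all add: frame_kernel)
  then show ?thesis by (simp add: frame_coframe[OF t])
qed

lemma copointed_bundle: "copointed_coalgebra_bundle P M C \<psi> (\<pi> 1) coactR"
proof -
  have J: "balancing P M = {t \<in> carr (P \<otimes> P). galois t = 0}"
    using balancing_subset galois_kernel by blast
  have "bij_betw (balanced_galois_map P C coactR) (balanced_tensor P M) (carr (P \<otimes> C))"
    using bij_betw_cosets[OF vspace_tensor lin_galois galois_surj J]
    by (simp add: balanced_galois_map_def[abs_def] balanced_tensor_def)
  then show ?thesis
    unfolding copointed_coalgebra_bundle_def
    using entwining grouplike_pi_one coactR_psi subalgebra_M coinvariants balancing_subset by auto
qed

section \<open>The comodule of augmented elements\<close>

lemma augmentation_subset: "augmentation P M \<subseteq> M"
  and eps_augmentation: "v \<in> augmentation P M \<Longrightarrow> eps v = 0"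
  by (auto simp: augmentation_def)

lemma subspace_augmentation: "module.subspace (scl P) (augmentation P M)"
proof -
  interpret vector_space "scl P" using vspace_P by (simp add: vspace_def)
  show ?thesis
    using subspace_M eps_lin(2)[of 0 0]
    by (intro subspaceI) (auto simp: augmentation_def subspace_0 subspace_add subspace_scale)
qed

lemma vspace_V: "vspace V"
  by (rule vspace_sub[OF vspace_P subspace_augmentation])

lemma tensor_sub_subset: "carr (A \<otimes> sub P N) \<subseteq> carr (A \<otimes> P)"
  by (rule tensor_mono) simp_all

text \<open>Exactness applied to \<open>\<epsilon>\<close> on \<open>M\<close>: this is how elements are shown to lie in \<open>A \<otimes> M\<^sup>+\<close>, since the chosen
  expansion of a coproduct only has second legs in \<open>M\<close>.\<close>
lemma tensor_augmentation:
  assumes A: "vspace A" and t: "t \<in> carr (A \<otimes> sub P M)" and t0: "tmap A P A ground id eps t = 0"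
  shows "t \<in> carr (A \<otimes> V)"
proof -
  have "tmap A (sub P M) A ground id eps t = 0"
    using tmap_restrict[OF A vspace_P subspace_M _ lin_id lin_eps t] t0 by simp
  from tensor_kernel_right[OF A vspace_M vspace_ground lin_restrict[OF lin_eps] t this]
  have "t \<in> carr (A \<otimes> sub (sub P M) (augmentation P M))" by (simp add: augmentation_def)
  then show ?thesis by (simp add: tensor_def)
qed

lemma pi_augmentation: "v \<in> augmentation P M \<Longrightarrow> \<pi> v = 0"
proof -
  interpret C: vector_space "scl C" using vspace_C by (simp add: vspace_def)
  show "v \<in> augmentation P M \<Longrightarrow> \<pi> v = 0"
    using pi_M_mult[of v 1] by (simp add: augmentation_def)
qed

text \<open>Applying \<open>id \<otimes> \<epsilon>\<close> to \<open>\<pi>(v\<^sub>1) \<otimes> v\<^sub>2\<close> gives \<open>\<pi>(v)\<close>, which is zero.\<close>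
lemma coactL_in: "v \<in> augmentation P M \<Longrightarrow> coactL v \<in> carr (C \<otimes> V)"
proof (rule tensor_augmentation[OF vspace_C])
  assume v: "v \<in> augmentation P M"
  then show "coactL v \<in> carr (C \<otimes> sub P M)"
    unfolding coactL_sw using augmentation_subset tens_in_tensor[of _ C _ "sub P M"]
    by (intro sw_in_coideal[OF vspace_tensor]) auto
  have "tmap C P C ground id eps (coactL v) = sw v (\<lambda>a b. tens C ground (\<pi> a) (eps b))"
    by (simp add: coaction_simps lin_eps)
  also have "\<dots> = sw v (\<lambda>a b. tscale (eps b) (tens C ground (\<pi> a) 1))"
    by (subst tens_ground) simp
  also have "\<dots> = tens C ground (\<pi> v) 1"
    using sw_counit_right[of funsp "\<lambda>a. tens C ground (\<pi> a) 1"] by (simp add: linear_simps)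
  also have "\<dots> = 0" by (simp add: pi_augmentation[OF v] zero_fun_def)
  finally show "tmap C P C ground id eps (coactL v) = 0" .
qed

lemma lin_coactL_V: "lin V (C \<otimes> V) coactL"
  using lin_coactL coactL_in by (auto simp: lin_def)

lemma comodule: "left_comodule C V coactL"
  unfolding left_comodule_def
proof (intro conjI ballI)
  show "vspace V" by (rule vspace_V)
  show "lin V (C \<otimes> V) coactL" by (rule lin_coactL_V)
next
  fix v assume v: "v \<in> carr V"
  then have cv: "coactL v \<in> carr (C \<otimes> V)" using coactL_in by simp
  have U: "augmentation P M \<subseteq> carr P" by simp
  have restrict: "tmap C V (C \<otimes> C) V (comul C) id (coactL v) = tmap C P (C \<otimes> C) P (comul C) id (coactL v)"
    "tmap C V C (C \<otimes> V) id coactL (coactL v) = tmap C P C (C \<otimes> P) id coactL (coactL v)"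
    using tmap_restrict[OF vspace_C vspace_P subspace_augmentation U lin_comul_C lin_id[of P] cv]
      tmap_restrict[OF vspace_C vspace_P subspace_augmentation U lin_id lin_coactL cv]
    unfolding tmap_def[of C V] by simp_all
  have "tmap C V (C \<otimes> C) V (comul C) id (coactL v) \<in> carr ((C \<otimes> C) \<otimes> V)"
    by (rule lin_in[OF lin_tmap cv]) (simp_all add: vspace_V lin_comul_C lin_id)
  then have "assoc_r C C V (tmap C V (C \<otimes> C) V (comul C) id (coactL v)) =
      assoc_r C C P (tmap C V (C \<otimes> C) V (comul C) id (coactL v))"
    by (intro assoc_r_restrict subspace_augmentation) simp_all
  also have "\<dots> = assoc_r C C P (tmap C P (C \<otimes> C) P (comul C) id (coactL v))"
    by (simp only: restrict)
  also have "\<dots> = sw v (\<lambda>a b. sw a (\<lambda>c d. tens C (C \<otimes> P) (\<pi> c) (tens C P (\<pi> d) b)))"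
    by (simp add: coaction_simps)
  also have "\<dots> = sw v (\<lambda>a b. sw b (\<lambda>c d. tens C (C \<otimes> P) (\<pi> a) (tens C P (\<pi> c) d)))"
    by (rule sw_coassoc[OF vspace_funsp]) (simp_all add: linear_simps)
  also have "\<dots> = tmap C P C (C \<otimes> P) id coactL (coactL v)"
    using lin_coactL by (simp add: coaction_simps)
  also have "\<dots> = tmap C V C (C \<otimes> V) id coactL (coactL v)"
    by (simp only: restrict)
  finally show "assoc_r C C V (tmap C V (C \<otimes> C) V (comul C) id (coactL v)) =
      tmap C V C (C \<otimes> V) id coactL (coactL v)" .
  have b: "bilin C P P (\<lambda>c w. scl P (counit C c) w)"
    using lin_counit_C by (simp add: linear_simps ground_def mult.commute)
  note U = tlift_universal(1,2)[OF vspace_C vspace_P vspace_P b]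
  have "tlift C V (\<lambda>c w. scl V (counit C c) w) (coactL v) = tlift C P (\<lambda>c w. scl P (counit C c) w) (coactL v)"
    unfolding scl_sub
    by (rule tlift_restrict[OF vspace_C vspace_P vspace_P b vspace_C vspace_V _ _ _ _ cv]) simp_all
  also have "\<dots> = sw v (\<lambda>a b. scl P (eps a) b)"
    unfolding coactL_sw by (subst lin_sw[OF vspace_tensor U(1)]) (simp_all add: tens_in_tensor U(2))
  also have "\<dots> = v" using sw_counit_left[OF vspace_P lin_id, of v] by simp
  finally show "tlift C V (\<lambda>c w. scl V (counit C c) w) (coactL v) = v" .
qed

section \<open>The one-form\<close>

lemma one_forms_iff: "t \<in> carr (one_forms P M) \<longleftrightarrow> t \<in> carr (sub P M \<otimes> sub P M) \<and> mult_map P t = 0"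
  by (simp add: one_forms_def)

text \<open>As \<open>S(v\<^sub>1) v\<^sub>2 = \<epsilon>(v) = 0\<close>, the term \<open>S(v\<^sub>1) v\<^sub>2 \<otimes> 1\<close> can be subtracted, and
  \<open>\<theta>(v) = S(v\<^sub>1) (1 \<otimes> v\<^sub>2 - v\<^sub>2 \<otimes> 1)\<close> with \<open>v\<^sub>2 \<in> M\<close>.\<close>
lemma theta_in:
  assumes v: "v \<in> augmentation P M"
  shows "\<theta> v \<in> carr (generated_one_forms P M)"
proof -
  have gen: "lact P P u (tens P P 1 b - tens P P b 1) \<in> carr (generated_one_forms P M)" if "b \<in> M" for u b
  proof -
    have "tens P P 1 b - tens P P b 1 \<in> carr (sub P M \<otimes> sub P M)"
      using that one_in_M tens_in_tensor[of _ "sub P M" _ "sub P M"]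
      by (intro vspace_diff[OF vspace_tensor]) simp_all
    moreover have "mult_map P (tens P P 1 b - tens P P b 1) = 0"
      by (subst lin_diff[OF vspace_tensor lin_mult_map]) (simp_all add: tens_in_tensor mult_map_tens)
    ultimately show ?thesis
      by (auto simp: generated_one_forms_def one_forms_iff intro!: ts.span_base)
  qed
  have vG: "vspace (generated_one_forms P M)"
    unfolding generated_one_forms_def by (rule vspace_sub[OF vspace_tensor]) (simp add: ts.subspace_span)
  have "sw v (\<lambda>a b. tens P P (S a * b) 1) = tens P P (sw v (\<lambda>a b. S a * b)) 1"
    by simp
  also have "\<dots> = 0" by (simp add: antipode_left eps_augmentation[OF v] zero_fun_def)
  finally have "\<theta> v = sw v (\<lambda>a b. tens P P (S a) b - tens P P (S a * b) 1)"
    by (simp add: theta_sw sw_minus)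
  also have "\<dots> = sw v (\<lambda>a b. lact P P (S a) (tens P P 1 b - tens P P b 1))"
    by (subst lin_diff[OF vspace_tensor lin_lact]) (simp_all add: tens_in_tensor lact_tens)
  also have "\<dots> \<in> carr (generated_one_forms P M)"
    using v augmentation_subset by (intro sw_in_coideal[OF vG] gen) auto
  finally show ?thesis .
qed

text \<open>The left side is \<open>(S v\<^sub>2)\<^sub>1 \<otimes> v\<^sub>3 \<otimes> \<pi>(v\<^sub>1 (S v\<^sub>2)\<^sub>2 v\<^sub>4)\<close>. Absorbing \<open>v\<^sub>1\<close> leaves \<open>S(v\<^sub>1) \<otimes> v\<^sub>2 \<otimes> \<pi>(v\<^sub>3)\<close>, and the
  last two legs are \<open>\<Delta>\<^sub>P\<close> of an element of \<open>M\<close>, which is coinvariant.\<close>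
lemma tensorial: "strongly_tensorial P M C \<psi> (\<pi> 1) V coactL \<theta>"
  unfolding strongly_tensorial_def
proof (intro conjI ballI)
  show "lin V (generated_one_forms P M) \<theta>"
    using lin_theta theta_in by (auto simp: lin_def generated_one_forms_def)
  fix v assume "v \<in> carr V"
  then have v: "v \<in> augmentation P M" and v_in_M: "v \<in> M" using augmentation_subset by auto
  have "entwine2 P C \<psi> (tmap C V C (P \<otimes> P) id \<theta> (coactL v)) =
      entwine2 P C \<psi> (tmap C P C (P \<otimes> P) id \<theta> (coactL v))"
    using tmap_restrict[OF vspace_C vspace_P subspace_augmentation _ lin_id lin_theta coactL_in[OF v]] by simp
  also have "\<dots> = sw v (\<lambda>a b. sw b (\<lambda>c d. sw (S c) (\<lambda>p q. sw d (\<lambda>x y.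
      tens (P \<otimes> P) C (tens P P p x) (\<pi> (a * q * y))))))"
    using lin_theta
    by (simp add: coaction_simps lin_sw[OF vspace_tensor lin_entwine2] entwine2_tens)
  also have "\<dots> = sw v (\<lambda>w d. sw w (\<lambda>a c. sw (S c) (\<lambda>p q. sw d (\<lambda>x y.
      tens (P \<otimes> P) C (tens P P p x) (\<pi> (a * q * y))))))"
    by (rule sw_coassoc[OF vspace_funsp, symmetric]) (simp_all add: linear_simps)
  also have "\<dots> = sw v (\<lambda>w d. sw d (\<lambda>x y. tens (P \<otimes> P) C (tens P P (S w) x) (\<pi> y)))"
    by (subst antipode_comul_absorb[where \<beta> = "\<lambda>p z. sw _ (\<lambda>x y. tens (P \<otimes> P) C (tens P P p x) (\<pi> (z * y)))"])
      (simp_all add: linear_simps)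
  also have "\<dots> = sw v (\<lambda>w d. assoc_l P P C (tens P (P \<otimes> C) (S w) (coactR d)))"
    by (simp add: coaction_simps)
  also have "\<dots> = sw v (\<lambda>w d. assoc_l P P C (tens P (P \<otimes> C) (S w) (tens P C d (\<pi> 1))))"
    using v_in_M coinvariants by (intro sw_cong) auto
  also have "\<dots> = tens (P \<otimes> P) C (\<theta> v) (\<pi> 1)"
    by (simp add: coaction_simps)
  finally show "entwine2 P C \<psi> (tmap C V C (P \<otimes> P) id \<theta> (coactL v)) = tens (P \<otimes> P) C (\<theta> v) (\<pi> 1)" .
qed


section \<open>The frame isomorphism\<close>

abbreviation E where "E \<equiv> cotensor P C coactR V coactL"
abbreviation Omega where "Omega \<equiv> one_forms P M"

text \<open>The two sides of the equation that defines \<open>E\<close>, extended from \<open>P \<otimes> V\<close> to \<open>P \<otimes> P\<close>.\<close>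
definition cot_left where "cot_left t = assoc_r P C P (tmap P P (P \<otimes> C) P coactR id t)"
definition cot_right where "cot_right t = tmap P P P (C \<otimes> P) id coactL t"

lemma lin_cot: "lin (P \<otimes> P) (P \<otimes> (C \<otimes> P)) cot_left" "lin (P \<otimes> P) (P \<otimes> (C \<otimes> P)) cot_right"
  unfolding cot_left_def[abs_def] cot_right_def[abs_def]
  by (rule lin_compose[OF lin_tmap lin_assoc_r] lin_tmap;
      simp add: lin_coactR lin_coactL lin_id vspace_tensor)+

lemma cot_left_tens: "cot_left (tens P P u v) = sw u (\<lambda>a b. tens P (C \<otimes> P) a (tens C P (\<pi> b) v))"
  and cot_left_M_mult: "m \<in> M \<Longrightarrow>
    cot_left (tens P P (m * u) v) = sw u (\<lambda>a b. tens P (C \<otimes> P) (m * a) (tens C P (\<pi> b) v))"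
  and cot_right_tens: "cot_right (tens P P u v) = sw v (\<lambda>a b. tens P (C \<otimes> P) u (tens C P (\<pi> a) b))"
proof -
  have *: "cot_left (tens P P u v) = assoc_r P C P (tens (P \<otimes> C) P (coactR u) v)" for u v
    unfolding cot_left_def by (simp add: tmap_tens lin_coactR lin_id)
  show "cot_left (tens P P u v) = sw u (\<lambda>a b. tens P (C \<otimes> P) a (tens C P (\<pi> b) v))"
    "m \<in> M \<Longrightarrow> cot_left (tens P P (m * u) v) = sw u (\<lambda>a b. tens P (C \<otimes> P) (m * a) (tens C P (\<pi> b) v))"
    unfolding * by (simp_all add: coactR_M_mult del: coactR_sw) (simp_all add: coaction_simps)
  show "cot_right (tens P P u v) = sw v (\<lambda>a b. tens P (C \<otimes> P) u (tens C P (\<pi> a) b))"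
    unfolding cot_right_def using lin_coactL by (simp add: coaction_simps)
qed

lemma cotensor_iff: "t \<in> carr E \<longleftrightarrow> t \<in> carr (P \<otimes> V) \<and> cot_left t = cot_right t"
proof -
  have U: "augmentation P M \<subseteq> carr P" by simp
  have "assoc_r P C V (tmap P V (P \<otimes> C) V coactR id t) = cot_left t"
    "tmap P V P (C \<otimes> V) id coactL t = cot_right t" if t: "t \<in> carr (P \<otimes> V)"
  proof -
    have "tmap P V (P \<otimes> C) V coactR id t \<in> carr ((P \<otimes> C) \<otimes> V)"
      by (rule lin_in[OF lin_tmap t]) (simp_all add: vspace_V lin_coactR lin_id)
    then have "assoc_r P C V (tmap P V (P \<otimes> C) V coactR id t) =
        assoc_r P C P (tmap P V (P \<otimes> C) V coactR id t)"
      by (intro assoc_r_restrict subspace_augmentation) simp_all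
    moreover have "tmap P V (P \<otimes> C) V coactR id t = tmap P P (P \<otimes> C) P coactR id t"
      using tmap_restrict[OF vspace_P vspace_P subspace_augmentation U lin_coactR lin_id[of P] t]
      unfolding tmap_def[of P V] by simp
    ultimately show "assoc_r P C V (tmap P V (P \<otimes> C) V coactR id t) = cot_left t"
      by (simp add: cot_left_def)
    show "tmap P V P (C \<otimes> V) id coactL t = cot_right t"
      using tmap_restrict[OF vspace_P vspace_P subspace_augmentation U lin_id lin_coactL t]
      unfolding tmap_def[of P V] cot_right_def by simp
  qed
  then show ?thesis unfolding cotensor_def by auto
qed

lemma frame_map_eq: "t \<in> carr (P \<otimes> V) \<Longrightarrow> frame_map P V \<theta> t = frame t"
proof -
  assume t: "t \<in> carr (P \<otimes> V)"
  have *: "lact P P u (\<theta> v) = sw v (\<lambda>a b. tens P P (u * S a) b)" for u v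
    by (simp add: coaction_simps)
  have b: "bilin P P (P \<otimes> P) (\<lambda>u v. sw v (\<lambda>a b. tens P P (u * S a) b))"
    by (simp add: linear_simps tens_in_tensor sw_in[OF vspace_tensor])
  show ?thesis
    unfolding frame_map_def frame_def *
    by (rule tlift_restrict[OF vspace_P vspace_P vspace_tensor b vspace_P vspace_V _ _ _ _ t]) simp_all
qed

lemma lact_V: "t \<in> carr (P \<otimes> V) \<Longrightarrow> lact P V m t = lact P P m t"
  unfolding lact_def
  using tmap_restrict[OF vspace_P vspace_P subspace_augmentation _ _ lin_id[of P], of P "\<lambda>x. m * x" t]
  unfolding tmap_def[of P V] by (simp add: linear_simps)

lemma frame_lact: "t \<in> carr (P \<otimes> P) \<Longrightarrow> frame (lact P P m t) = lact P P m (frame t)"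
  by (rule tensor_lin_eq[OF vspace_P lin_compose[OF lin_lact lin_frame] lin_compose[OF lin_frame lin_lact]])
    (simp_all add: frame_tens coaction_simps mult.assoc)

lemma cotensor_lact:
  assumes m: "m \<in> M" and t: "t \<in> carr E"
  shows "lact P V m t \<in> carr E"
proof -
  have tV: "t \<in> carr (P \<otimes> V)" and eq: "cot_left t = cot_right t"
    using t by (simp_all add: cotensor_iff)
  have tP: "t \<in> carr (P \<otimes> P)" using tV tensor_sub_subset by blast
  have l: "lin (P \<otimes> (C \<otimes> P)) (P \<otimes> (C \<otimes> P)) (lact P (C \<otimes> P) m)" by (simp add: lin_lact vspace_tensor)
  have "cot_left (lact P P m t) = lact P (C \<otimes> P) m (cot_left t)"
    by (rule tensor_lin_eq[OF vspace_P lin_compose[OF lin_lact lin_cot(1)] lin_compose[OF lin_cot(1) l] tP])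
      (simp_all add: lact_tens cot_left_M_mult[OF m], simp add: cot_left_tens coaction_simps)
  also have "\<dots> = lact P (C \<otimes> P) m (cot_right t)" by (simp add: eq)
  also have "\<dots> = cot_right (lact P P m t)"
    by (rule tensor_lin_eq[OF vspace_P lin_compose[OF lin_cot(2) l] lin_compose[OF lin_lact lin_cot(2)] tP])
      (simp_all add: cot_right_tens coaction_simps)
  finally show ?thesis
    using lin_in[OF lin_lact[OF vspace_V] tV, of m] by (simp add: cotensor_iff lact_V[OF tV])
qed

lemma one_forms_ambient: "carr (sub P M \<otimes> sub P M) \<subseteq> carr (P \<otimes> P)"
  by (rule tensor_mono) simp_all

lemma one_forms_lact:
  assumes m: "m \<in> M" and t: "t \<in> carr Omega"
  shows "lact P P m t \<in> carr Omega"
proof -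
  have tM: "t \<in> carr (sub P M \<otimes> sub P M)" and t0: "mult_map P t = 0"
    using t by (simp_all add: one_forms_iff)
  have tP: "t \<in> carr (P \<otimes> P)" using tM one_forms_ambient by blast
  have "lact P P m t \<in> carr (sub P M \<otimes> sub P M)"
  proof (rule tensor_lin_into_subspace[OF vspace_M vspace_tensor lin_restrict[OF lin_lact[OF vspace_P] one_forms_ambient] tM])
    show "module.subspace (scl (P \<otimes> P)) (carr (sub P M \<otimes> sub P M))"
      using vspace_tensor[of "sub P M" "sub P M"] by (simp add: vspace_def)
    show "lact P P m (tens (sub P M) (sub P M) a b) \<in> carr (sub P M \<otimes> sub P M)"
      if "a \<in> carr (sub P M)" "b \<in> carr (sub P M)" for a b
      using tens_in_tensor[of "m * a" "sub P M" b "sub P M"] that m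
      by (simp add: lact_tens mult_in_M)
  qed simp
  moreover have "mult_map P (lact P P m t) = m * mult_map P t"
    by (rule tensor_lin_eq[OF vspace_P lin_compose[OF lin_lact lin_mult_map], where Y = P and g = "\<lambda>t. m * mult_map P t"])
      (use tP lin_mult_map in \<open>simp_all add: lact_tens mult_map_tens mult.assoc lin_def distrib_left\<close>)
  ultimately show ?thesis by (simp add: one_forms_iff t0)
qed

text \<open>For \<open>t = \<Sum> a \<otimes> b\<close> in \<open>M \<otimes> M\<close> both sides of the cotensor equation for \<open>\<kappa> t = \<Sum> a b\<^sub>1 \<otimes> b\<^sub>2\<close> are
  \<open>\<Sum> a b\<^sub>1 \<otimes> \<pi>(b\<^sub>2) \<otimes> b\<^sub>3\<close>, as \<open>a\<close> is in \<open>M\<close>. The second leg of \<open>\<kappa> t\<close> is in \<open>M\<^sup>+\<close> because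
  \<open>(id \<otimes> \<epsilon>)(\<kappa> t)\<close> is the product of \<open>t\<close>.\<close>
lemma coframe_one_forms:
  assumes t: "t \<in> carr Omega"
  shows "coframe t \<in> carr E"
proof -
  have tM: "t \<in> carr (sub P M \<otimes> sub P M)" and t0: "mult_map P t = 0"
    using t by (simp_all add: one_forms_iff)
  have tP: "t \<in> carr (P \<otimes> P)" using tM one_forms_ambient by blast
  have "coframe t \<in> carr (P \<otimes> sub P M)"
  proof (rule tensor_lin_into_subspace[OF vspace_M vspace_tensor lin_restrict[OF lin_coframe one_forms_ambient] tM])
    show "module.subspace (scl (P \<otimes> P)) (carr (P \<otimes> sub P M))"
      using vspace_tensor[of P "sub P M"] by (simp add: vspace_def)
    show "coframe (tens (sub P M) (sub P M) a b) \<in> carr (P \<otimes> sub P M)"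
      if "a \<in> carr (sub P M)" "b \<in> carr (sub P M)" for a b
      using that tens_in_tensor[of _ P _ "sub P M"]
      by (simp add: coframe_tens sw_in_coideal[OF vspace_tensor])
  qed simp
  moreover have "tmap P P P ground id eps (coframe t) = tens P ground (mult_map P t) 1"
  proof (rule tensor_lin_eq[OF vspace_P lin_compose[OF lin_coframe lin_tmap[OF vspace_P vspace_P lin_id lin_eps]]
        lin_compose[OF lin_mult_map], OF _ tP])
    show "lin P (P \<otimes> ground) (\<lambda>x. tens P ground x 1)"
      by (simp add: lin_def tens_bilinear tens_in_tensor ground_def)
    fix u v
    have "tmap P P P ground id eps (coframe (tens P P u v)) =
        sw v (\<lambda>a b. tscale (eps b) (tens P ground (u * a) 1))"
      unfolding coframe_tens by (simp add: sweedler_simps lin_eps) (subst tens_ground, simp)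
    also have "\<dots> = tens P ground (u * v) 1"
      using sw_counit_right[of funsp "\<lambda>a. tens P ground (u * a) 1"] by (simp add: linear_simps)
    finally show "tmap P P P ground id eps (coframe (tens P P u v)) =
        tens P ground (mult_map P (tens P P u v)) 1" by (simp add: mult_map_tens)
  qed
  ultimately have "coframe t \<in> carr (P \<otimes> V)"
    by (intro tensor_augmentation) (simp_all add: t0 zero_fun_def)
  moreover have "cot_left (coframe t) = cot_right (coframe t)"
  proof (rule tensor_lin_eq[OF vspace_M lin_restrict[OF lin_compose[OF lin_coframe lin_cot(1)] one_forms_ambient]
        lin_restrict[OF lin_compose[OF lin_coframe lin_cot(2)] one_forms_ambient] tM])
    fix a b assume "a \<in> carr (sub P M)"
    then have a: "a \<in> M" by simp
    have "cot_left (coframe (tens P P a b)) = sw b (\<lambda>x y. cot_left (tens P P (a * x) y))"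
      by (simp add: coframe_tens lin_sw[OF vspace_tensor lin_cot(1)] tens_in_tensor)
    also have "\<dots> = sw b (\<lambda>x y. sw x (\<lambda>p q. tens P (C \<otimes> P) (a * p) (tens C P (\<pi> q) y)))"
      by (simp add: cot_left_M_mult[OF a])
    also have "\<dots> = sw b (\<lambda>x y. sw y (\<lambda>p q. tens P (C \<otimes> P) (a * x) (tens C P (\<pi> p) q)))"
      by (rule sw_coassoc[OF vspace_funsp]) (simp_all add: linear_simps)
    also have "\<dots> = cot_right (coframe (tens P P a b))"
      by (simp add: coframe_tens lin_sw[OF vspace_tensor lin_cot(2)] tens_in_tensor cot_right_tens)
    finally show "cot_left (coframe (tens (sub P M) (sub P M) a b)) =
        cot_right (coframe (tens (sub P M) (sub P M) a b))" by simp
  qed simp_all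
  ultimately show ?thesis by (simp add: cotensor_iff)
qed

text \<open>The composite \<open>C \<otimes> P \<rightarrow> P \<otimes> C \<otimes> P\<close>, \<open>c \<otimes> v \<mapsto> \<psi>(c \<otimes> S(v\<^sub>1)) \<otimes> v\<^sub>2\<close>. Going through \<open>\<psi>\<close> makes it evident that
  \<open>\<pi>(y (S v\<^sub>1)\<^sub>2)\<close> depends on \<open>y\<close> only through \<open>\<pi>(y)\<close>.\<close>
definition twist where
  "twist s = tmap (C \<otimes> P) P (P \<otimes> C) P \<psi> id (assoc_l C P P (tmap C P C (P \<otimes> P) id \<theta> s))"

lemma lin_twist: "lin (C \<otimes> P) ((P \<otimes> C) \<otimes> P) twist"
  unfolding twist_def[abs_def]
  by (rule lin_compose[OF lin_compose[OF lin_tmap lin_assoc_l] lin_tmap])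
    (simp_all add: lin_theta lin_id lin_psi vspace_tensor)

lemma twist_tens: "twist (tens C P (\<pi> y) v) =
    sw v (\<lambda>c d. sw (S c) (\<lambda>p q. tens (P \<otimes> C) P (tens P C p (\<pi> (y * q))) d))"
  unfolding twist_def using lin_theta by (simp add: coaction_simps)

definition act_triple where "act_triple x = tmap (P \<otimes> C) P (P \<otimes> C) P (lact P C x) id"

lemma bilin_act_triple: "bilin P ((P \<otimes> C) \<otimes> P) ((P \<otimes> C) \<otimes> P) act_triple"
proof -
  have "bilin P (P \<otimes> C) (P \<otimes> C) (lact P C)"
    unfolding lact_def[abs_def] tmap_def
    by (rule tlift_bilin_right[OF vspace_P vspace_C vspace_tensor vspace_P])
      (simp_all add: linear_simps tens_in_tensor)
  then have "lin P ((P \<otimes> C) \<otimes> P) (\<lambda>x. tens (P \<otimes> C) P (lact P C x t) d)"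
    if "t \<in> carr (P \<otimes> C)" for t d
    using that by (simp add: bilin_def lin_def tens_bilinear tens_in_tensor)
  then show ?thesis
    unfolding act_triple_def[abs_def] tmap_def
    by (intro tlift_bilin_right vspace_tensor vspace_P bilin_tens_compose lin_lact) (simp_all add: lin_id[unfolded id_def] vspace_C)
qed

lemma act_triple_tens: "c \<in> carr C \<Longrightarrow>
  act_triple x (tens (P \<otimes> C) P (tens P C a c) v) = tens (P \<otimes> C) P (tens P C (x * a) c) v"
  unfolding act_triple_def by (simp add: tmap_tens vspace_tensor lin_lact lin_id tens_in_tensor lact_tens)

text \<open>The map \<open>x \<otimes> \<pi>(y) \<otimes> v \<mapsto> x (S v\<^sub>1)\<^sub>1 \<otimes> \<pi>(y (S v\<^sub>1)\<^sub>2) \<otimes> v\<^sub>2\<close>, which turns the cotensor equation for \<open>t\<close> into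
  coinvariance of the first leg of \<open>s(t)\<close>.\<close>
definition insert_antipode where "insert_antipode = tlift P (C \<otimes> P) (\<lambda>x s. act_triple x (twist s))"

lemma lin_insert_antipode: "lin (P \<otimes> (C \<otimes> P)) ((P \<otimes> C) \<otimes> P) insert_antipode"
  and insert_antipode_tens: "insert_antipode (tens P (C \<otimes> P) x (tens C P (\<pi> y) v)) =
    sw v (\<lambda>c d. sw (S c) (\<lambda>p q. tens (P \<otimes> C) P (tens P C (x * p) (\<pi> (y * q))) d))"
proof -
  have "bilin P (C \<otimes> P) ((P \<otimes> C) \<otimes> P) (\<lambda>x s. act_triple x (twist s))"
    using bilin_act_triple lin_twist by (simp add: bilin_def lin_def)
  note U = tlift_universal(1,2)[OF vspace_P vspace_tensor vspace_tensor this, folded insert_antipode_def]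
  show "lin (P \<otimes> (C \<otimes> P)) ((P \<otimes> C) \<otimes> P) insert_antipode" by (rule U)
  have l: "lin ((P \<otimes> C) \<otimes> P) ((P \<otimes> C) \<otimes> P) (act_triple x)" for x
    using bilin_act_triple by (simp add: bilin_def)
  show "insert_antipode (tens P (C \<otimes> P) x (tens C P (\<pi> y) v)) =
    sw v (\<lambda>c d. sw (S c) (\<lambda>p q. tens (P \<otimes> C) P (tens P C (x * p) (\<pi> (y * q))) d))"
    by (simp add: U(2) tens_in_tensor twist_tens lin_sw[OF vspace_tensor l] sw_in[OF vspace_tensor] act_triple_tens)
qed

text \<open>Here \<open>(u\<^sub>1 \<otimes> u\<^sub>2) \<Delta>(S v\<^sub>1)\<close> is \<open>\<Delta>(u S(v\<^sub>1))\<close>.\<close>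
lemma insert_antipode_cot_left:
  "t \<in> carr (P \<otimes> P) \<Longrightarrow> insert_antipode (cot_left t) = tmap P P (P \<otimes> C) P coactR id (frame t)"
proof (rule tensor_lin_eq[OF vspace_P lin_compose[OF lin_cot(1) lin_insert_antipode] lin_compose[OF lin_frame lin_tmap]])
  fix u v
  have "insert_antipode (cot_left (tens P P u v)) = sw u (\<lambda>a b. sw v (\<lambda>c d. sw (S c) (\<lambda>p q.
      tens (P \<otimes> C) P (tens P C (a * p) (\<pi> (b * q))) d)))"
    by (simp add: cot_left_tens lin_sw[OF vspace_tensor lin_insert_antipode] tens_in_tensor insert_antipode_tens)
  also have "\<dots> = sw v (\<lambda>c d. sw u (\<lambda>a b. sw (S c) (\<lambda>p q.
      tens (P \<otimes> C) P (tens P C (a * p) (\<pi> (b * q))) d)))"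
    by (rule sw_swap)
  also have "\<dots> = sw v (\<lambda>c d. sw (u * S c) (\<lambda>p q. tens (P \<otimes> C) P (tens P C p (\<pi> q)) d))"
    by (subst sw_mult[OF vspace_funsp]) (simp_all add: linear_simps)
  also have "\<dots> = tmap P P (P \<otimes> C) P coactR id (frame (tens P P u v))"
    using lin_coactR by (simp add: frame_tens coaction_simps)
  finally show "insert_antipode (cot_left (tens P P u v)) = tmap P P (P \<otimes> C) P coactR id (frame (tens P P u v))" .
qed (simp_all add: lin_coactR lin_id)

lemma lin_tens_grouplike: "lin P (P \<otimes> C) (\<lambda>u. tens P C u (\<pi> 1))"
  by (simp add: linear_simps tens_in_tensor)

text \<open>Here the middle leg is \<open>\<pi>(v\<^sub>1 (S v\<^sub>2)\<^sub>2)\<close>, and \<open>antipode_comul_absorb\<close> reduces it to \<open>\<pi>(1)\<close>.\<close>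
lemma insert_antipode_cot_right:
  "t \<in> carr (P \<otimes> P) \<Longrightarrow> insert_antipode (cot_right t) = tmap P P (P \<otimes> C) P (\<lambda>u. tens P C u (\<pi> 1)) id (frame t)"
proof (rule tensor_lin_eq[OF vspace_P lin_compose[OF lin_cot(2) lin_insert_antipode] lin_compose[OF lin_frame lin_tmap]])
  fix u v
  have "insert_antipode (cot_right (tens P P u v)) = sw v (\<lambda>a b. sw b (\<lambda>c d. sw (S c) (\<lambda>p q.
      tens (P \<otimes> C) P (tens P C (u * p) (\<pi> (a * q))) d)))"
    by (simp add: cot_right_tens lin_sw[OF vspace_tensor lin_insert_antipode] tens_in_tensor insert_antipode_tens)
  also have "\<dots> = sw v (\<lambda>w d. sw w (\<lambda>a c. sw (S c) (\<lambda>p q.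
      tens (P \<otimes> C) P (tens P C (u * p) (\<pi> (a * q))) d)))"
    by (rule sw_coassoc[OF vspace_funsp, symmetric]) (simp_all add: linear_simps)
  also have "\<dots> = sw v (\<lambda>w d. tens (P \<otimes> C) P (tens P C (u * S w) (\<pi> 1)) d)"
    by (subst antipode_comul_absorb[where \<beta> = "\<lambda>p z. tens (P \<otimes> C) P (tens P C (u * p) (\<pi> z)) _"])
      (simp_all add: linear_simps)
  also have "\<dots> = tmap P P (P \<otimes> C) P (\<lambda>u. tens P C u (\<pi> 1)) id (frame (tens P P u v))"
    using lin_tens_grouplike by (simp add: frame_tens coaction_simps)
  finally show "insert_antipode (cot_right (tens P P u v)) =
    tmap P P (P \<otimes> C) P (\<lambda>u. tens P C u (\<pi> 1)) id (frame (tens P P u v))" .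
qed (simp_all add: lin_tens_grouplike lin_id)

text \<open>The two lemmas above make \<open>\<Delta>\<^sub>P - (\<cdot> \<otimes> \<pi>(1))\<close> vanish on the first leg of \<open>s(t)\<close>, so by exactness that leg
  is in \<open>M\<close>; the second leg is in \<open>M\<close> because the coproduct of \<open>M\<close> is in \<open>P \<otimes> M\<close>.\<close>
lemma frame_cotensor:
  assumes t: "t \<in> carr E"
  shows "frame t \<in> carr Omega"
proof -
  have tV: "t \<in> carr (P \<otimes> V)" and eq: "cot_left t = cot_right t"
    using t by (simp_all add: cotensor_iff)
  have tP: "t \<in> carr (P \<otimes> P)" using tV tensor_sub_subset by blast
  have fPM: "frame t \<in> carr (P \<otimes> sub P M)"
  proof (rule tensor_lin_into_subspace[OF vspace_P vspace_tensor lin_restrict[OF lin_frame tensor_sub_subset] tV])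
    show "module.subspace (scl (P \<otimes> P)) (carr (P \<otimes> sub P M))"
      using vspace_tensor[of P "sub P M"] by (simp add: vspace_def)
    show "frame (tens P V a b) \<in> carr (P \<otimes> sub P M)" if "b \<in> carr V" for a b
      using that augmentation_subset tens_in_tensor[of _ P _ "sub P M"]
      by (simp add: frame_tens subset_iff sw_in_coideal[OF vspace_tensor])
  qed simp
  have mult: "mult_map P (frame t) = 0"
  proof (rule tensor_lin_eq[OF vspace_P lin_restrict[OF lin_compose[OF lin_frame lin_mult_map] tensor_sub_subset],
        where Y = P and g = "\<lambda>t. 0", OF _ _ tV])
    fix u v assume "v \<in> carr V"
    then have "eps v = 0" by (simp add: eps_augmentation)
    have "mult_map P (frame (tens P P u v)) = u * sw v (\<lambda>a b. S a * b)"
      by (simp add: frame_tens lin_sw[OF vspace_tensor lin_mult_map] tens_in_tensor mult_map_tens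
          sw_mult_left mult.assoc)
    then show "mult_map P (frame (tens P V u v)) = 0"
      using \<open>eps v = 0\<close> by (simp add: antipode_left)
  qed (simp_all add: lin_def)
  let ?D = "\<lambda>u. coactR u - tens P C u (\<pi> 1)"
  have D: "lin P (P \<otimes> C) ?D"
    by (rule lin_minus[OF vspace_tensor lin_coactR lin_tens_grouplike])
  have D_eq: "tmap P P (P \<otimes> C) P ?D id s = tmap P P (P \<otimes> C) P coactR id s -
      tmap P P (P \<otimes> C) P (\<lambda>u. tens P C u (\<pi> 1)) id s" if s: "s \<in> carr (P \<otimes> P)" for s
    by (rule tensor_lin_eq[OF vspace_P lin_tmap[OF vspace_P vspace_P D lin_id] lin_minus[OF vspace_tensor
          lin_tmap[OF vspace_P vspace_P lin_coactR lin_id] lin_tmap[OF vspace_P vspace_P lin_tens_grouplike lin_id]] s])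
      (simp add: tmap_tens D lin_coactR lin_tens_grouplike lin_id tens_diff)
  have "tmap P (sub P M) (P \<otimes> C) (sub P M) ?D id (frame t) = tmap P P (P \<otimes> C) P ?D id (frame t)"
    using tmap_restrict[OF vspace_P vspace_P subspace_M _ D lin_id[of P] fPM]
    unfolding tmap_def[of P "sub P M"] by simp
  also have "\<dots> = 0"
    using insert_antipode_cot_left[OF tP] insert_antipode_cot_right[OF tP] eq by (simp add: D_eq lin_in[OF lin_frame tP])
  finally have "frame t \<in> carr (sub P {a \<in> carr P. ?D a = 0} \<otimes> sub P M)"
    by (rule tensor_kernel_left[OF vspace_P vspace_M vspace_tensor D fPM])
  moreover have "{a \<in> carr P. ?D a = 0} = M" using coinvariants by auto
  ultimately show ?thesis using mult by (simp add: one_forms_iff)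
qed

lemma frame_isomorphism: "left_module_iso M E (lact P V) Omega (lact P P) (frame_map P V \<theta>)"
  unfolding left_module_iso_def
proof (intro conjI ballI)
  have EV: "carr E \<subseteq> carr (P \<otimes> V)" by (auto simp: cotensor_iff)
  have EP: "carr E \<subseteq> carr (P \<otimes> P)" using EV tensor_sub_subset by blast
  have fr: "frame_map P V \<theta> t = frame t" if "t \<in> carr E" for t
    using that EV frame_map_eq by blast
  have sclE: "scl E = tscale" "scl Omega = tscale" by (simp_all add: cotensor_def one_forms_def)
  have "ts.subspace (carr E)"
  proof (rule ts.subspaceI)
    note lr = lin_restrict[OF lin_cot(1) tensor_sub_subset[of P "augmentation P M"]]
      lin_restrict[OF lin_cot(2) tensor_sub_subset[of P "augmentation P M"]]
    show "0 \<in> carr E"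
      unfolding cotensor_iff using lin_zero[OF vspace_tensor lr(1)]
        lin_zero[OF vspace_tensor lr(2)] vspace_zero[OF vspace_tensor, of P V]
      by simp
    show "x + y \<in> carr E" if "x \<in> carr E" "y \<in> carr E" for x y
      using that unfolding cotensor_iff
      by (simp add: vspace_add[OF vspace_tensor] lin_add[OF lr(1)] lin_add[OF lr(2)])
    show "tscale c x \<in> carr E" if "x \<in> carr E" for c x
      using that vspace_scale[OF vspace_tensor, of x P V c] unfolding cotensor_iff
      by (simp add: lin_scale[OF lr(1), simplified] lin_scale[OF lr(2), simplified])
  qed
  then have vE: "vspace E" by (simp add: vspace_def sclE vector_space_tscale)
  show "lact P V m x \<in> carr E" if "m \<in> M" "x \<in> carr E" for m x using that by (rule cotensor_lact)
  show "lact P P m y \<in> carr Omega" if "m \<in> M" "y \<in> carr Omega" for m y using that by (rule one_forms_lact)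
  show "frame_map P V \<theta> (lact P V m x) = lact P P m (frame_map P V \<theta> x)"
    if "m \<in> M" "x \<in> carr E" for m x
    using that cotensor_lact[OF that] EV EP by (auto simp: fr frame_lact lact_V subset_iff)
  show "lin E Omega (frame_map P V \<theta>)"
    using vspace_add[OF vE] vspace_scale[OF vE] lin_restrict[OF lin_frame EP]
    by (simp add: lin_def fr frame_cotensor sclE)
  show "bij_betw (frame_map P V \<theta>) (carr E) (carr Omega)"
  proof (rule bij_betw_byWitness[where f' = coframe])
    show "\<forall>a\<in>carr E. coframe (frame_map P V \<theta> a) = a"
      using EP coframe_frame by (auto simp: fr)
    show "\<forall>a\<in>carr Omega. frame_map P V \<theta> (coframe a) = a"
      using coframe_one_forms frame_coframe one_forms_ambient by (auto simp: fr one_forms_iff)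
    show "frame_map P V \<theta> ` carr E \<subseteq> carr Omega" using frame_cotensor by (auto simp: fr)
    show "coframe ` carr Omega \<subseteq> carr E" using coframe_one_forms by blast
  qed
qed

end

theorem proposition5p10:
  fixes P :: "('k::field, 'p::ring_1) hopf"
    and M :: "'p set"
    and C :: "('k, 'c::ab_group_add) coalg"
    and \<pi> :: "'p \<Rightarrow> 'c"
  defines "V \<equiv> sub P (augmentation P M)"
    and "\<Delta>V \<equiv> (\<lambda>v. tmap P P C P \<pi> id (comul P v))"
    and "\<theta> \<equiv> (\<lambda>v. tmap P P P P (antipode P) id (comul P v))"
    and "\<psi> \<equiv> canonical_entwining P C \<pi>"
  assumes "quantum_embeddable_homogeneous_space P M C \<pi>"
    and "bij_betw \<psi> (carr (C \<otimes> P)) (carr (P \<otimes> C))"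
  shows "coalgebra_frame_resolution P M C \<psi> (\<pi> 1) (right_coaction P C \<pi>) V \<Delta>V \<theta>"
proof -
  interpret embeddable_space P M C \<pi> by unfold_locales (rule assms(5))
  show ?thesis
    unfolding coalgebra_frame_resolution_def V_def \<Delta>V_def \<theta>_def \<psi>_def
    using copointed_bundle assms(6) comodule tensorial frame_isomorphism unfolding \<psi>_def by blast
qed

end
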